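(* The square formed by the functors $\mathcal P^o_f:\mathbf{RegOp}\to\mathbf{FOp}$, $\mathcal E^f_o:\mathbf{FOp}\to\mathbf{ET}$, $\mathcal E^r_o:\mathbf{RegOp}\to\mathbf{RegET}$ and the inclusion $\mathcal P^e_f:\mathbf{RegET}\to\mathbf{ET}$ commutes up to a natural isomorphism, i.e. $\mathcal E^f_o\circ\mathcal P^o_f\cong\mathcal P^e_f\circ\mathcal E^r_o$.
   Context: Notation: $(n]=\{1,\dots,n\}$ for $n\in\omega=\{0,1,2,\dots\}$. $\mathbb F$ is the category with objects $(n]$, $n\in\omega$, and all functions as morphisms; $\mathbb S$ (resp. $\mathbb I$) is its subcategory with the same objects and surjections (resp. injections). **Operads.** For $\phi\in\mathbb F(n,m)$ and $\psi_i\in\mathbb F(k_i,l_i)$, $i\in(m]$, let $\langle\psi_1,\dots,\psi_m\rangle\star\phi:\sum_{j=1}^n(k_{\phi(j)}]\to\sum_{i=1}^m(l_i]$ be the function sending the element $r$ of the $j$-th summand to the element $\psi_{\phi(j)}(r)$ of the $\phi(j)$-th summand (sums ordered lexicographically). A full operad $\mathcal O$ consists of sets $\mathcal O_n$ ($n\in\omega$), a unit $\iota\in\mathcal O_1$, multiplications $\mathcal O_{n_1}\times\dots\times\mathcal O_{n_k}\times\mathcal O_k\to\mathcal O_{n_1+\dots+n_k}$, $(b_1,\dots,b_k,a)\mapsto\langle b_1,\dots,b_k\rangle\ast a$, and a left (functorial) action $\cdot:\mathbb F(n,m)\times\mathcal O_n\to\mathcal O_m$, such that $\ast$ is associative, $\langle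 a\rangle\ast\iota=a=\langle\iota,\dots,\iota\rangle\ast a$, and $\langle\psi_1\cdot b_1,\dots,\psi_m\cdot b_m\rangle\ast(\phi\cdot a)=(\langle\psi_1,\dots,\psi_m\rangle\star\phi)\cdot(\langle b_{\phi(1)},\dots,b_{\phi(n)}\rangle\ast a)$. A regular operad is defined in the same way with $\mathbb F$ replaced by $\mathbb S$. Morphisms preserve arities, unit, multiplication and action. The categories are $\mathbf{FOp}$ and $\mathbf{RegOp}$. **$\mathcal P^o_f$** (left adjoint to the restriction of the action to $\mathbb S$): $\mathcal P^o_f(\mathcal O)_n=\coprod_{k\in\omega}\mathbb I(k,n)\otimes_k\mathcal O_k$, where $\otimes_k$ means the quotient of the product by $(f\circ\sigma,a)\sim(f,\sigma\cdot a)$, $\sigma\in S_k$; action $\phi\cdot[f,a]=[f',\phi'\cdot a]$ where $\phi\circ f=f'\circ\phi'$ with $\phi'$ surjective and $f'$ injective; unit $[1_1,\iota]$; composition $\langle[f_1,b_1],\dots,[f_m,b_m]\rangle\ast[f,a]=[\langle f_1,\dots,f_m\rangle\star f,\langle b_{f(1)},\dots,b_{f(k)}\rangle\ast a]$ for $f\in\mathbb I(k,m)$; on morphisms $[f,a]\mapsto[f,h(a)]$. **Equational theories.** An equational theory is a pair $T=(L,A)$ with $L$ a finitary signature and $A$ a set of equations in context $s=t:\vec x^n$, where $\vec x^n=x_1,\dots,x_n$ and $s,t$ are $L$-terms with variables among $x_1,\dots,x_n$; provability is the usual equational logic of equations in context. An interpretation $I:(L,A)\to(L',A')$ assigns to each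 $n$-ary symbol of $L$ an $L'$-term in context $\vec x^n$, so that (after extending to all terms by substitution) the axioms in $A$ are sent to equations provable from $A'$; two interpretations are identified if they send each symbol to provably equal terms. This gives the category $\mathbf{ET}$. A term in context $t:\vec x^n$ is regular if each of $x_1,\dots,x_n$ occurs in $t$. A theory is regular if it has a set of axioms (equivalent to $A$) in which each equation has the same variables on both sides; an interpretation is regular if it sends each $n$-ary symbol to a regular term in context $\vec x^n$. $\mathbf{RegET}\subset\mathbf{ET}$ is the subcategory of regular theories and regular interpretations. **$\mathcal E^f_o$ and $\mathcal E^r_o$.** For a full (resp. regular) operad $\mathcal O$, the theory $\mathcal E^f_o(\mathcal O)$ (resp. $\mathcal E^r_o(\mathcal O)$) has $\mathcal O_n$ as the set of $n$-ary symbols and axioms: $\iota(x_1)=x_1:\vec x^1$; $a(x_{\tau(1)},\dots,x_{\tau(m)})=(\tau\cdot a)(x_1,\dots,x_n):\vec x^n$ for all $a\in\mathcal O_m$ and all functions (resp. all surjections) $\tau:(m]\to(n]$; and $a(a_1(x_1,\dots,x_{k_1}),\dots,a_m(x_{k-k_m+1},\dots,x_k))=(\langle a_1,\dots,a_m\rangle\ast a)(x_1,\dots,x_k):\vec x^k$ for $a\in\mathcal O_m$, $a_i\in\mathcal O_{k_i}$, $k=\sum_ik_i$. A morphism $h$ is sent to the interpretation $a\mapsto h(a)(x_1,\dots,x_n):\vec x^n$ for $a$ of arity $n$. *)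

theory Defs
  imports "HOL-Library.FuncSet" "HOL-Library.FSet"
begin

section \<open>Categories, functors, natural isomorphisms\<close>

record ('o, 'm) cat =
  Ob :: "'o set"
  Hom :: "'o \<Rightarrow> 'o \<Rightarrow> 'm set"
  Ident :: "'o \<Rightarrow> 'm"
  Cmp :: "'o \<Rightarrow> 'o \<Rightarrow> 'o \<Rightarrow> 'm \<Rightarrow> 'm \<Rightarrow> 'm"

text \<open>\<open>Cmp C X Y Z g f\<close> is the composite of \<open>f : X \<rightarrow> Y\<close> followed by \<open>g : Y \<rightarrow> Z\<close>. Since an arrow
  is always used together with its domain and codomain, hom-sets need not be disjoint.\<close>

locale category =
  fixes C :: "('o, 'm) cat"
  assumes Ident_in_Hom: "X \<in> Ob C \<Longrightarrow> Ident C X \<in> Hom C X X"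
    and Cmp_in_Hom: "\<lbrakk>X \<in> Ob C; Y \<in> Ob C; Z \<in> Ob C; f \<in> Hom C X Y; g \<in> Hom C Y Z\<rbrakk>
      \<Longrightarrow> Cmp C X Y Z g f \<in> Hom C X Z"
    and Cmp_Ident_right: "\<lbrakk>X \<in> Ob C; Y \<in> Ob C; f \<in> Hom C X Y\<rbrakk>
      \<Longrightarrow> Cmp C X X Y f (Ident C X) = f"
    and Cmp_Ident_left: "\<lbrakk>X \<in> Ob C; Y \<in> Ob C; f \<in> Hom C X Y\<rbrakk>
      \<Longrightarrow> Cmp C X Y Y (Ident C Y) f = f"
    and Cmp_assoc: "\<lbrakk>W \<in> Ob C; X \<in> Ob C; Y \<in> Ob C; Z \<in> Ob C;
        f \<in> Hom C W X; g \<in> Hom C X Y; h \<in> Hom C Y Z\<rbrakk>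
      \<Longrightarrow> Cmp C W Y Z h (Cmp C W X Y g f) = Cmp C W X Z (Cmp C X Y Z h g) f"

record ('o, 'm, 'p, 'n) ftor =
  on_ob :: "'o \<Rightarrow> 'p"
  on_arr :: "'o \<Rightarrow> 'o \<Rightarrow> 'm \<Rightarrow> 'n"

locale is_functor = C: category C + D: category D
  for C :: "('o, 'm) cat" and D :: "('p, 'n) cat" and F :: "('o, 'm, 'p, 'n) ftor" +
  assumes on_ob_in_Ob: "X \<in> Ob C \<Longrightarrow> on_ob F X \<in> Ob D"
    and on_arr_in_Hom: "\<lbrakk>X \<in> Ob C; Y \<in> Ob C; f \<in> Hom C X Y\<rbrakk>
      \<Longrightarrow> on_arr F X Y f \<in> Hom D (on_ob F X) (on_ob F Y)"
    and on_arr_Ident: "X \<in> Ob C \<Longrightarrow> on_arr F X X (Ident C X) = Ident D (on_ob F X)"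
    and on_arr_Cmp: "\<lbrakk>X \<in> Ob C; Y \<in> Ob C; Z \<in> Ob C; f \<in> Hom C X Y; g \<in> Hom C Y Z\<rbrakk>
      \<Longrightarrow> on_arr F X Z (Cmp C X Y Z g f) =
          Cmp D (on_ob F X) (on_ob F Y) (on_ob F Z) (on_arr F Y Z g) (on_arr F X Y f)"

definition ftor_comp ::
  "('p, 'n, 'q, 'r) ftor \<Rightarrow> ('o, 'm, 'p, 'n) ftor \<Rightarrow> ('o, 'm, 'q, 'r) ftor" (infixl "\<circ>\<^sub>F" 55)
  where "G \<circ>\<^sub>F F = \<lparr>on_ob = (\<lambda>X. on_ob G (on_ob F X)),
    on_arr = (\<lambda>X Y f. on_arr G (on_ob F X) (on_ob F Y) (on_arr F X Y f))\<rparr>"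

definition is_iso :: "('o, 'm) cat \<Rightarrow> 'o \<Rightarrow> 'o \<Rightarrow> 'm \<Rightarrow> bool"
  where "is_iso C X Y f \<longleftrightarrow> f \<in> Hom C X Y \<and>
    (\<exists>g \<in> Hom C Y X. Cmp C X Y X g f = Ident C X \<and> Cmp C Y X Y f g = Ident C Y)"

definition naturally_isomorphic ::
  "('o, 'm) cat \<Rightarrow> ('p, 'n) cat \<Rightarrow> ('o, 'm, 'p, 'n) ftor \<Rightarrow> ('o, 'm, 'p, 'n) ftor \<Rightarrow> bool"
  where "naturally_isomorphic C D F G \<longleftrightarrow> is_functor C D F \<and> is_functor C D G \<and>
    (\<exists>\<eta>. (\<forall>X \<in> Ob C. is_iso D (on_ob F X) (on_ob G X) (\<eta> X)) \<and>
      (\<forall>X \<in> Ob C. \<forall>Y \<in> Ob C. \<forall>f \<in> Hom C X Y.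
        Cmp D (on_ob F X) (on_ob F Y) (on_ob G Y) (\<eta> Y) (on_arr F X Y f) =
        Cmp D (on_ob F X) (on_ob G X) (on_ob G Y) (on_arr G X Y f) (\<eta> X)))"


section \<open>Functions between finite sets\<close>

text \<open>The set \<open>(n]\<close> is rendered as \<open>{..<n}\<close>, i.e. all indices are shifted by one, and a function
  \<open>\<phi> : (n] \<rightarrow> (m]\<close> is rendered as the list \<open>[\<phi>(0), \<dots>, \<phi>(n - 1)]\<close> of its values. The list
  determines the domain but not the codomain of the function.\<close>

definition Fmor :: "nat \<Rightarrow> nat \<Rightarrow> nat list set"
  where "Fmor n m = {\<phi>. length \<phi> = n \<and> set \<phi> \<subseteq> {..<m}}"

definition Smor :: "nat \<Rightarrow> nat \<Rightarrow> nat list set"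
  where "Smor n m = {\<phi> \<in> Fmor n m. set \<phi> = {..<m}}"

definition Imor :: "nat \<Rightarrow> nat \<Rightarrow> nat list set"
  where "Imor n m = {\<phi> \<in> Fmor n m. distinct \<phi>}"

abbreviation Perm :: "nat \<Rightarrow> nat list set"
  where "Perm k \<equiv> Smor k k \<inter> Imor k k"

definition fid :: "nat \<Rightarrow> nat list"
  where "fid n = [0..<n]"

definition fcomp :: "nat list \<Rightarrow> nat list \<Rightarrow> nat list"
  where "fcomp \<psi> \<phi> = map (\<lambda>i. \<psi> ! i) \<phi>"

text \<open>\<open>star ls \<psi>s \<phi>\<close> is \<open>\<langle>\<psi>\<^sub>1, \<dots>, \<psi>\<^sub>m\<rangle> \<star> \<phi>\<close>, where \<open>ls = [l\<^sub>1, \<dots>, l\<^sub>m]\<close> lists the codomains of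
  the \<open>\<psi>\<^sub>i\<close>. In a lexicographically ordered sum, the element \<open>r\<close> of the summand with index \<open>i\<close>
  is \<open>sum_list (take i ls) + r\<close>.\<close>

definition star :: "nat list \<Rightarrow> nat list list \<Rightarrow> nat list \<Rightarrow> nat list"
  where "star ls \<psi>s \<phi> = concat (map (\<lambda>i. map (\<lambda>r. sum_list (take i ls) + r) (\<psi>s ! i)) \<phi>)"


section \<open>Operads\<close>

text \<open>\<open>mul \<O> [n\<^sub>1, \<dots>, n\<^sub>k] [b\<^sub>1, \<dots>, b\<^sub>k] a\<close> is \<open>\<langle>b\<^sub>1, \<dots>, b\<^sub>k\<rangle> \<ast> a\<close>, where \<open>n\<^sub>i\<close> is the arity
  of \<open>b\<^sub>i\<close> and \<open>k\<close> that of \<open>a\<close>; the arities are arguments because the sets \<open>\<O>\<^sub>n\<close> need not be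
  disjoint. \<open>act \<O> m \<phi> a\<close> is \<open>\<phi> \<cdot> a\<close> for \<open>\<phi>\<close> with codomain \<open>(m]\<close> and \<open>a\<close> of arity \<open>length \<phi>\<close>.
  Values at other arguments are irrelevant.\<close>

record 'a operad =
  Ops :: "nat \<Rightarrow> 'a set"
  iota :: 'a
  mul :: "nat list \<Rightarrow> 'a list \<Rightarrow> 'a \<Rightarrow> 'a"
  act :: "nat \<Rightarrow> nat list \<Rightarrow> 'a \<Rightarrow> 'a"

text \<open>Operads whose action is by the morphisms in \<open>H\<close>, to be instantiated with \<open>Fmor\<close> (full
  operads) and \<open>Smor\<close> (regular operads).\<close>

locale operad =
  fixes H :: "nat \<Rightarrow> nat \<Rightarrow> nat list set" and \<O> :: "'a operad"
  assumes iota_closed: "iota \<O> \<in> Ops \<O> 1"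
    and mul_closed: "\<lbrakk>list_all2 (\<lambda>n b. b \<in> Ops \<O> n) ns bs; a \<in> Ops \<O> (length ns)\<rbrakk>
      \<Longrightarrow> mul \<O> ns bs a \<in> Ops \<O> (sum_list ns)"
    and act_closed: "\<lbrakk>\<phi> \<in> H n m; a \<in> Ops \<O> n\<rbrakk> \<Longrightarrow> act \<O> m \<phi> a \<in> Ops \<O> m"
    and act_id: "a \<in> Ops \<O> n \<Longrightarrow> act \<O> n (fid n) a = a"
    and act_comp: "\<lbrakk>\<phi> \<in> H n m; \<psi> \<in> H m l; a \<in> Ops \<O> n\<rbrakk>
      \<Longrightarrow> act \<O> l (fcomp \<psi> \<phi>) a = act \<O> l \<psi> (act \<O> m \<phi> a)"
    and mul_assoc: "\<lbrakk>list_all2 (list_all2 (\<lambda>m c. c \<in> Ops \<O> m)) mss css;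
        list_all2 (\<lambda>ms b. b \<in> Ops \<O> (length ms)) mss bs; a \<in> Ops \<O> (length mss)\<rbrakk>
      \<Longrightarrow> mul \<O> (map sum_list mss)
            (map (\<lambda>i. mul \<O> (mss ! i) (css ! i) (bs ! i)) [0..<length mss]) a =
          mul \<O> (concat mss) (concat css) (mul \<O> (map length mss) bs a)"
    and mul_iota_right: "a \<in> Ops \<O> n \<Longrightarrow> mul \<O> [n] [a] (iota \<O>) = a"
    and mul_iota_left: "a \<in> Ops \<O> n \<Longrightarrow> mul \<O> (replicate n 1) (replicate n (iota \<O>)) a = a"
    and mul_act: "\<lbrakk>\<phi> \<in> H n m; a \<in> Ops \<O> n; length ks = m; length ls = m; length \<psi>s = m;
        length bs = m; \<And>i. i < m \<Longrightarrow> \<psi>s ! i \<in> H (ks ! i) (ls ! i);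
        \<And>i. i < m \<Longrightarrow> bs ! i \<in> Ops \<O> (ks ! i)\<rbrakk>
      \<Longrightarrow> mul \<O> ls (map (\<lambda>i. act \<O> (ls ! i) (\<psi>s ! i) (bs ! i)) [0..<m]) (act \<O> m \<phi> a) =
          act \<O> (sum_list ls) (star ls \<psi>s \<phi>)
            (mul \<O> (map (\<lambda>i. ks ! i) \<phi>) (map (\<lambda>i. bs ! i) \<phi>) a)"

definition operad_hom ::
  "(nat \<Rightarrow> nat \<Rightarrow> nat list set) \<Rightarrow> 'a operad \<Rightarrow> 'a operad \<Rightarrow> (nat \<Rightarrow> 'a \<Rightarrow> 'a) set"
  where "operad_hom H \<O> \<O>' = {h.
    (\<forall>n. h n \<in> Ops \<O> n \<rightarrow>\<^sub>E Ops \<O>' n) \<and>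
    h 1 (iota \<O>) = iota \<O>' \<and>
    (\<forall>ns bs a. list_all2 (\<lambda>n b. b \<in> Ops \<O> n) ns bs \<and> a \<in> Ops \<O> (length ns) \<longrightarrow>
      h (sum_list ns) (mul \<O> ns bs a) = mul \<O>' ns (map2 h ns bs) (h (length ns) a)) \<and>
    (\<forall>n m \<phi> a. \<phi> \<in> H n m \<and> a \<in> Ops \<O> n \<longrightarrow> h m (act \<O> m \<phi> a) = act \<O>' m \<phi> (h n a))}"

type_synonym 'a operad_cat = "('a operad, nat \<Rightarrow> 'a \<Rightarrow> 'a) cat"

definition Op_cat :: "(nat \<Rightarrow> nat \<Rightarrow> nat list set) \<Rightarrow> 'a operad_cat"
  where "Op_cat H = \<lparr>Ob = {\<O>. operad H \<O>}, Hom = operad_hom H,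
    Ident = (\<lambda>\<O> n. \<lambda>a \<in> Ops \<O> n. a),
    Cmp = (\<lambda>\<O> \<O>' \<O>'' g f n. compose (Ops \<O> n) (g n) (f n))\<rparr>"

definition FOp :: "'a operad_cat"
  where "FOp = Op_cat Fmor"

definition RegOp :: "'a operad_cat"
  where "RegOp = Op_cat Smor"


section \<open>The functor from regular to full operads\<close>

text \<open>A type that contains arbitrary elements and is closed under forming tensor classes, so that
  an operad with elements in \<open>'u elt\<close> is sent to an operad with elements in \<open>'u elt\<close>.
  \<open>Tensor k X\<close> is a class \<open>X\<close> of pairs \<open>(f, a)\<close>, placed in the \<open>k\<close>-th summand of the coproduct.
  The classes are finite, as the class of \<open>(f, a)\<close> is its orbit under the symmetric group \<open>S\<^sub>k\<close>.\<close>

datatype 'u elt = Elem 'u | Tensor nat "(nat list \<times> 'u elt) fset"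

definition tensor_step ::
  "'a operad \<Rightarrow> nat \<Rightarrow> nat \<Rightarrow> ((nat list \<times> 'a) \<times> (nat list \<times> 'a)) set"
  where "tensor_step \<O> k n =
    {((fcomp f \<sigma>, a), (f, act \<O> k \<sigma> a)) | f \<sigma> a. f \<in> Imor k n \<and> \<sigma> \<in> Perm k \<and> a \<in> Ops \<O> k}"

definition tensor_equiv ::
  "'a operad \<Rightarrow> nat \<Rightarrow> nat \<Rightarrow> ((nat list \<times> 'a) \<times> (nat list \<times> 'a)) set"
  where "tensor_equiv \<O> k n = (tensor_step \<O> k n \<union> (tensor_step \<O> k n)\<inverse>)\<^sup>*"

definition tensor :: "'u elt operad \<Rightarrow> nat \<Rightarrow> nat \<Rightarrow> nat list \<Rightarrow> 'u elt \<Rightarrow> 'u elt"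
  where "tensor \<O> k n f a = Tensor k (Abs_fset (tensor_equiv \<O> k n `` {(f, a)}))"

definition P_ob :: "'u elt operad \<Rightarrow> 'u elt operad"
  where "P_ob \<O> = \<lparr>
    Ops = (\<lambda>n. {tensor \<O> k n f a | k f a. f \<in> Imor k n \<and> a \<in> Ops \<O> k}),
    iota = tensor \<O> 1 1 (fid 1) (iota \<O>),
    mul = (\<lambda>ns ys x. THE z. \<exists>k f a ks fs bs.
      f \<in> Imor k (length ns) \<and> a \<in> Ops \<O> k \<and> x = tensor \<O> k (length ns) f a \<and>
      length ks = length ns \<and> length fs = length ns \<and> length bs = length ns \<and>
      (\<forall>i < length ns. fs ! i \<in> Imor (ks ! i) (ns ! i) \<and> bs ! i \<in> Ops \<O> (ks ! i) \<and>
        ys ! i = tensor \<O> (ks ! i) (ns ! i) (fs ! i) (bs ! i)) \<and>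
      z = tensor \<O> (sum_list (map (\<lambda>i. ks ! i) f)) (sum_list ns) (star ns fs f)
            (mul \<O> (map (\<lambda>i. ks ! i) f) (map (\<lambda>i. bs ! i) f) a)),
    act = (\<lambda>m \<phi> x. THE y. \<exists>k f a l f' \<phi>'.
      f \<in> Imor k (length \<phi>) \<and> a \<in> Ops \<O> k \<and> x = tensor \<O> k (length \<phi>) f a \<and>
      \<phi>' \<in> Smor k l \<and> f' \<in> Imor l m \<and> fcomp \<phi> f = fcomp f' \<phi>' \<and>
      y = tensor \<O> l m f' (act \<O> l \<phi>' a))\<rparr>"

definition P_arr ::
  "'u elt operad \<Rightarrow> 'u elt operad \<Rightarrow> (nat \<Rightarrow> 'u elt \<Rightarrow> 'u elt) \<Rightarrow> (nat \<Rightarrow> 'u elt \<Rightarrow> 'u elt)"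
  where "P_arr \<O> \<O>' h n = (\<lambda>x \<in> Ops (P_ob \<O>) n. THE y. \<exists>k f a.
    f \<in> Imor k n \<and> a \<in> Ops \<O> k \<and> x = tensor \<O> k n f a \<and> y = tensor \<O>' k n f (h k a))"

definition P_of ::
  "('u elt operad, nat \<Rightarrow> 'u elt \<Rightarrow> 'u elt, 'u elt operad, nat \<Rightarrow> 'u elt \<Rightarrow> 'u elt) ftor"
  where "P_of = \<lparr>on_ob = P_ob, on_arr = P_arr\<rparr>"


section \<open>Equational theories\<close>

text \<open>A signature is a family \<open>L :: nat \<Rightarrow> 's set\<close>, with \<open>L n\<close> the set of \<open>n\<close>-ary symbols. These
  sets need not be disjoint: \<open>App s ts\<close> is the application of the symbol \<open>s\<close> of arity
  \<open>length ts\<close>. The variable \<open>x\<^sub>i\<^sub>+\<^sub>1\<close> is \<open>Var i\<close>.\<close>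

datatype 's trm = Var nat | App 's "'s trm list"

primrec vars :: "'s trm \<Rightarrow> nat set"
  where
    "vars (Var i) = {i}"
  | "vars (App s ts) = \<Union> (set (map vars ts))"

primrec subst :: "(nat \<Rightarrow> 's trm) \<Rightarrow> 's trm \<Rightarrow> 's trm"
  where
    "subst \<sigma> (Var i) = \<sigma> i"
  | "subst \<sigma> (App s ts) = App s (map (subst \<sigma>) ts)"

inductive_set terms :: "(nat \<Rightarrow> 's set) \<Rightarrow> nat \<Rightarrow> 's trm set"
  for L :: "nat \<Rightarrow> 's set" and n :: nat
  where
    Var: "i < n \<Longrightarrow> Var i \<in> terms L n"
  | App: "\<lbrakk>s \<in> L (length ts); \<And>t. t \<in> set ts \<Longrightarrow> t \<in> terms L n\<rbrakk> \<Longrightarrow> App s ts \<in> terms L n"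

text \<open>The triple \<open>(n, s, t)\<close> is the equation \<open>s = t\<close> in the context \<open>x\<^sub>1, \<dots>, x\<^sub>n\<close>.\<close>

record 's eqthy =
  Sym :: "nat \<Rightarrow> 's set"
  Ax :: "(nat \<times> 's trm \<times> 's trm) set"

definition eq_theory :: "'s eqthy \<Rightarrow> bool"
  where "eq_theory T \<longleftrightarrow> (\<forall>(n, s, t) \<in> Ax T. s \<in> terms (Sym T) n \<and> t \<in> terms (Sym T) n)"

inductive provable :: "'s eqthy \<Rightarrow> nat \<Rightarrow> 's trm \<Rightarrow> 's trm \<Rightarrow> bool"
  for T :: "'s eqthy"
  where
    axiom: "(n, s, t) \<in> Ax T \<Longrightarrow> provable T n s t"
  | refl: "t \<in> terms (Sym T) n \<Longrightarrow> provable T n t t"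
  | sym: "provable T n s t \<Longrightarrow> provable T n t s"
  | trans: "\<lbrakk>provable T n s t; provable T n t u\<rbrakk> \<Longrightarrow> provable T n s u"
  | cong: "\<lbrakk>f \<in> Sym T (length ss); length ts = length ss;
      \<And>i. i < length ss \<Longrightarrow> provable T n (ss ! i) (ts ! i)\<rbrakk>
      \<Longrightarrow> provable T n (App f ss) (App f ts)"
  | subst: "\<lbrakk>provable T n s t; \<And>i. i < n \<Longrightarrow> \<sigma> i \<in> terms (Sym T) m\<rbrakk>
      \<Longrightarrow> provable T m (subst \<sigma> s) (subst \<sigma> t)"

text \<open>An interpretation is given by its values \<open>I n s\<close> at the \<open>n\<close>-ary symbols \<open>s\<close>.\<close>

type_synonym 's intp = "nat \<Rightarrow> 's \<Rightarrow> 's trm"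

primrec extend :: "'s intp \<Rightarrow> 's trm \<Rightarrow> 's trm"
  where
    "extend I (Var i) = Var i"
  | "extend I (App s ts) = subst (\<lambda>i. map (extend I) ts ! i) (I (length ts) s)"

definition interpretations :: "'s eqthy \<Rightarrow> 's eqthy \<Rightarrow> 's intp set"
  where "interpretations T T' = {I.
    (\<forall>n. \<forall>s \<in> Sym T n. I n s \<in> terms (Sym T') n) \<and>
    (\<forall>(n, s, t) \<in> Ax T. provable T' n (extend I s) (extend I t))}"

definition intp_class :: "'s eqthy \<Rightarrow> 's eqthy \<Rightarrow> 's intp \<Rightarrow> 's intp set"
  where "intp_class T T' I =
    {J \<in> interpretations T T'. \<forall>n. \<forall>s \<in> Sym T n. provable T' n (I n s) (J n s)}"

definition generic :: "nat \<Rightarrow> 's \<Rightarrow> 's trm"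
  where "generic n s = App s (map Var [0..<n])"

type_synonym 's eqthy_cat = "('s eqthy, 's intp set) cat"

definition ET :: "'s eqthy_cat"
  where "ET = \<lparr>Ob = {T. eq_theory T},
    Hom = (\<lambda>T T'. intp_class T T' ` interpretations T T'),
    Ident = (\<lambda>T. intp_class T T generic),
    Cmp = (\<lambda>T T' T'' d c. \<Union>I \<in> c. \<Union>J \<in> d. intp_class T T'' (\<lambda>n s. extend J (I n s)))\<rparr>"

definition regular_theory :: "'s eqthy \<Rightarrow> bool"
  where "regular_theory T \<longleftrightarrow> eq_theory T \<and>
    (\<exists>A. eq_theory (T\<lparr>Ax := A\<rparr>) \<and>
      (\<forall>n s t. provable (T\<lparr>Ax := A\<rparr>) n s t \<longleftrightarrow> provable T n s t) \<and>
      (\<forall>(n, s, t) \<in> A. vars s = vars t))"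

definition regular_interpretation :: "'s eqthy \<Rightarrow> 's intp \<Rightarrow> bool"
  where "regular_interpretation T I \<longleftrightarrow> (\<forall>n. \<forall>s \<in> Sym T n. vars (I n s) = {..<n})"

text \<open>In a regular theory, provably equal terms have the same variables, so all members of a class
  of interpretations into such a theory are regular as soon as one of them is.\<close>

definition RegET :: "'s eqthy_cat"
  where "RegET = \<lparr>Ob = {T. regular_theory T},
    Hom = (\<lambda>T T'. {c \<in> Hom ET T T'. \<exists>I \<in> c. regular_interpretation T I}),
    Ident = Ident ET,
    Cmp = Cmp ET\<rparr>"

definition P_ef :: "('s eqthy, 's intp set, 's eqthy, 's intp set) ftor"
  where "P_ef = \<lparr>on_ob = (\<lambda>T. T), on_arr = (\<lambda>T T' c. c)\<rparr>"


section \<open>The functors from operads to equational theories\<close>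

definition E_ob :: "(nat \<Rightarrow> nat \<Rightarrow> nat list set) \<Rightarrow> 'a operad \<Rightarrow> 'a eqthy"
  where "E_ob H \<O> = \<lparr>Sym = Ops \<O>,
    Ax = {(1, App (iota \<O>) [Var 0], Var 0)} \<union>
      {(n, App a (map Var \<tau>), generic n (act \<O> n \<tau> a)) | m n \<tau> a. \<tau> \<in> H m n \<and> a \<in> Ops \<O> m} \<union>
      {(sum_list ns,
        App a (map (\<lambda>i. App (bs ! i)
          (map Var [sum_list (take i ns)..<sum_list (take (Suc i) ns)])) [0..<length ns]),
        generic (sum_list ns) (mul \<O> ns bs a)) | ns bs a.
          list_all2 (\<lambda>n b. b \<in> Ops \<O> n) ns bs \<and> a \<in> Ops \<O> (length ns)}\<rparr>"

definition E_arr :: "(nat \<Rightarrow> nat \<Rightarrow> nat list set) \<Rightarrow> 'a operad \<Rightarrow> 'a operad \<Rightarrow>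
    (nat \<Rightarrow> 'a \<Rightarrow> 'a) \<Rightarrow> 'a intp set"
  where "E_arr H \<O> \<O>' h = intp_class (E_ob H \<O>) (E_ob H \<O>') (\<lambda>n a. generic n (h n a))"

definition E_fo :: "('a operad, nat \<Rightarrow> 'a \<Rightarrow> 'a, 'a eqthy, 'a intp set) ftor"
  where "E_fo = \<lparr>on_ob = E_ob Fmor, on_arr = E_arr Fmor\<rparr>"

definition E_ro :: "('a operad, nat \<Rightarrow> 'a \<Rightarrow> 'a, 'a eqthy, 'a intp set) ftor"
  where "E_ro = \<lparr>on_ob = E_ob Smor, on_arr = E_arr Smor\<rparr>"

end

theory Submission
  imports Defs
begin

text \<open>In \<open>\<P>\<^sup>o\<^sub>f(\<O>)\<close> every operation is a class \<open>[f, a]\<close> with \<open>a\<close> an operation of the regular operad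
  and \<open>f\<close> an injection that adds dummy variables, so it means the term \<open>a(x\<^bsub>f(1)\<^esub>, \<dots>, x\<^bsub>f(k)\<^esub>)\<close> of
  \<open>\<E>\<^sup>r\<^sub>o(\<O>)\<close>. Reading classes as these terms is an interpretation \<open>\<E>\<^sup>f\<^sub>o(\<P>\<^sup>o\<^sub>f(\<O>)) \<rightarrow> \<E>\<^sup>r\<^sub>o(\<O>)\<close>, and its
  inverse sends \<open>a\<close> to \<open>[1, a]\<close>, because \<open>[f, a] = f \<cdot> [1, a]\<close>. That \<open>\<P>\<^sup>o\<^sub>f(\<O>)\<close> is a full operad rests on
  the uniqueness up to a permutation of the factorization of a function into a surjection followed
  by an injection, and on the interchange law for \<open>\<star>\<close>.\<close>

section \<open>Finite functions and lexicographic sums\<close>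

text \<open>The operations of \<open>P_ob\<close> are definite descriptions over all
  representatives, so nothing can be computed before independence of representatives is known.
  \<open>act_P\<close> and \<open>mul_P\<close> settle this once: they accept arbitrary
  representatives, and \<open>act_P\<close> also an arbitrary factorization. After that each operad
  law is checked on convenient representatives and splits into two halves, an identity between
  functions encoded as lists and the corresponding law of the given regular operad.

  \<open>unpack\<close> chooses representatives too, and arrows of \<open>ET\<close> are classes up
  to provable equality; \<open>extend_unpack\<close> removes the choice by a proof in the regular
  theory. The isomorphism has to live in \<open>ET\<close>: if \<open>f\<close> is not surjective,
  \<open>unpack\<close> sends \<open>[f, a]\<close> to a term that misses some variables of its
  context, and such \<open>f\<close> always exist because of the class of \<open>iota\<close> under
  an injection from \<open>(1]\<close> to \<open>(2]\<close>.\<close>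

lemma nth_concat_offset:
  assumes "i < length xss" "r < length (xss ! i)"
  shows "sum_list (take i (map length xss)) + r < length (concat xss)"
    and "concat xss ! (sum_list (take i (map length xss)) + r) = xss ! i ! r"
  using assms
proof (induction xss arbitrary: i)
  case (Cons xs xss)
  { case 1 then show ?case using Cons by (cases i) (auto simp: add.assoc) }
  { case 2 then show ?case using Cons by (cases i) (auto simp: nth_append add.assoc) }
qed auto

text \<open>With \<open>offset_inject\<close> this makes the encoding of a pair
  \<open>(i, r)\<close> as \<open>sum_list (take i ls) + r\<close> a bijection from the
  lexicographic sum onto \<open>{..<sum_list ls}\<close>.\<close>

lemma offset_cases:
  assumes "x < sum_list (ls :: nat list)"
  obtains i r where "i < length ls" "r < ls ! i" "x = sum_list (take i ls) + r"
  using assms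
proof (induction ls arbitrary: x thesis)
  case (Cons l ls)
  show ?case
  proof (cases "x < l")
    case True then show ?thesis using Cons.prems(1)[of 0 x] by auto
  next
    case False
    then have "x - l < sum_list ls" using Cons.prems(2) by auto
    then obtain i r where "i < length ls" "r < ls ! i" "x - l = sum_list (take i ls) + r"
      using Cons.IH by blast
    then show ?thesis using Cons.prems(1)[of "Suc i" r] False by auto
  qed
qed auto

lemma sum_list_take_mono: "i \<le> j \<Longrightarrow> sum_list (take i ls) \<le> sum_list (take j (ls :: nat list))"
  by (metis le_add1 le_add_diff_inverse sum_list_append take_add)

lemma sum_list_take_Suc: "i < length ls \<Longrightarrow>
    sum_list (take (Suc i) ls) = sum_list (take i ls) + ls ! i" for ls :: "nat list"
  by (simp add: take_Suc_conv_app_nth)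

lemma offset_less_next: "\<lbrakk>i < j; j < length ls; r < ls ! i\<rbrakk> \<Longrightarrow>
    sum_list (take i ls) + r < sum_list (take j ls)" for ls :: "nat list"
  using sum_list_take_mono[of "Suc i" j ls] sum_list_take_Suc[of i ls] by simp

lemma offset_less: "\<lbrakk>i < length ls; r < ls ! i\<rbrakk> \<Longrightarrow>
    sum_list (take i ls) + r < sum_list ls" for ls :: "nat list"
  using sum_list_take_mono[of "Suc i" "length ls" ls] sum_list_take_Suc[of i ls] by simp

lemma offset_inject:
  fixes ls :: "nat list"
  assumes "sum_list (take i ls) + r = sum_list (take j ls) + s" "i < length ls" "j < length ls"
    "r < ls ! i" "s < ls ! j"
  shows "i = j \<and> r = s"
  using assms offset_less_next[of i j ls r] offset_less_next[of j i ls s]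
  by (cases i j rule: linorder_cases) auto

text \<open>For the multiplication axioms: their \<open>i\<close>-th inner operation receives the
  variables of this interval, so substituting the list \<open>concat xss\<close> for the variables
  hands it exactly \<open>xss ! i\<close>.\<close>

lemma map_nth_concat_slice:
  assumes "i < length xss"
  shows "map ((!) (concat xss)) [sum_list (take i (map length xss))..<
      sum_list (take (Suc i) (map length xss))] = xss ! i"
  using assms nth_concat_offset(2)[of i xss]
  by (intro nth_equalityI) (auto simp: sum_list_take_Suc)

text \<open>In a sum of sums, the offset of a summand is the offset of its outer block plus its
  offset inside that block. Associativity of \<open>star\<close> rests on this.\<close>

lemma sum_list_take_concat:
  fixes mss :: "nat list list"
  assumes "i < length mss" "r \<le> length (mss ! i)"
  shows "sum_list (take (sum_list (take i (map length mss)) + r) (concat mss)) =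
    sum_list (take i (map sum_list mss)) + sum_list (take r (mss ! i))"
  using assms
proof (induction mss arbitrary: i)
  case (Cons ms mss)
  then show ?case by (cases i) (auto simp: add.assoc)
qed auto

section \<open>Maps between finite sets, permutations and image factorization\<close>

lemma Fmor_nth: "\<phi> \<in> Fmor n m \<Longrightarrow> i < n \<Longrightarrow> \<phi> ! i < m"
  by (auto simp: Fmor_def subset_iff)

lemma Smor_Fmor: "\<phi> \<in> Smor n m \<Longrightarrow> \<phi> \<in> Fmor n m" and Imor_Fmor: "\<phi> \<in> Imor n m \<Longrightarrow> \<phi> \<in> Fmor n m"
  by (auto simp: Smor_def Imor_def)

lemma Fmor_length: "\<phi> \<in> Fmor n m \<Longrightarrow> length \<phi> = n"
  by (auto simp: Fmor_def)

lemma Imor_length: "\<phi> \<in> Imor n m \<Longrightarrow> length \<phi> = n" and Smor_length: "\<phi> \<in> Smor n m \<Longrightarrow> length \<phi> = n"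
  by (auto simp: Imor_def Smor_def Fmor_def)

lemma fid_in [simp]: "fid n \<in> Fmor n n" "fid n \<in> Smor n n" "fid n \<in> Imor n n"
  by (auto simp: fid_def Fmor_def Smor_def Imor_def)

lemma fcomp_Fmor: "\<phi> \<in> Fmor n m \<Longrightarrow> \<psi> \<in> Fmor m l \<Longrightarrow> fcomp \<psi> \<phi> \<in> Fmor n l"
  by (force simp: Fmor_def fcomp_def subset_iff)

lemma fcomp_Smor: "\<phi> \<in> Smor n m \<Longrightarrow> \<psi> \<in> Smor m l \<Longrightarrow> fcomp \<psi> \<phi> \<in> Smor n l"
  by (auto simp: Smor_def fcomp_def Fmor_def set_conv_nth[of \<psi>] image_def lessThan_def Bex_def)

lemma fcomp_Imor: "\<phi> \<in> Imor n m \<Longrightarrow> \<psi> \<in> Imor m l \<Longrightarrow> fcomp \<psi> \<phi> \<in> Imor n l"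
  using fcomp_Fmor[of \<phi> n m \<psi> l]
  by (auto simp: Imor_def fcomp_def Fmor_def distinct_map inj_on_def nth_eq_iff_index_eq subset_iff)

text \<open>The hypotheses keep the entries of \<open>\<phi>\<close> in range of
  \<open>\<psi>\<close>, since \<open>!\<close> has no specified value past the end of a
  list.\<close>

lemma fcomp_assoc: "\<lbrakk>\<phi> \<in> Fmor n m; length \<psi> = m\<rbrakk> \<Longrightarrow>
    fcomp (fcomp \<chi> \<psi>) \<phi> = fcomp \<chi> (fcomp \<psi> \<phi>)"
  by (auto simp: fcomp_def Fmor_def)

lemma fcomp_fid: "length \<phi> = n \<Longrightarrow> fcomp \<phi> (fid n) = \<phi>"
  by (auto simp: fcomp_def fid_def map_nth)

lemma fid_fcomp: "\<phi> \<in> Fmor n m \<Longrightarrow> fcomp (fid m) \<phi> = \<phi>"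
  by (auto simp: fcomp_def fid_def Fmor_def subset_iff intro!: map_idI)

lemma bij_mor_eq: "\<sigma> \<in> Smor k l \<Longrightarrow> \<sigma> \<in> Imor k l \<Longrightarrow> k = l"
  by (auto simp: Smor_def Imor_def Fmor_def dest: distinct_card)

lemma finite_Perm: "finite (Perm k)"
  by (rule finite_subset[of _ "{xs. set xs \<subseteq> {..<k} \<and> length xs = k}"])
    (auto simp: Imor_def Fmor_def finite_lists_length_eq)

text \<open>A repetition-free list is an injection, and \<open>g\<close> inverts it on its image.
  This yields inverse permutations and the surjective half of image factorizations.\<close>

lemma distinct_nth_inverse:
  assumes "distinct xs"
  obtains g where "\<And>i. i < length xs \<Longrightarrow> g (xs ! i) = i"
    "\<And>x. x \<in> set xs \<Longrightarrow> g x < length xs \<and> xs ! g x = x" "g ` set xs = {..<length xs}"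
proof -
  define g where "g = (\<lambda>x. THE i. i < length xs \<and> xs ! i = x)"
  have g: "g (xs ! i) = i" if "i < length xs" for i
    unfolding g_def using that assms by (intro the_equality) (auto simp: nth_eq_iff_index_eq)
  moreover have "g x < length xs \<and> xs ! g x = x" if "x \<in> set xs" for x
    using that g by (metis in_set_conv_nth)
  moreover have "g ` set xs = {..<length xs}"
  proof
    show "g ` set xs \<subseteq> {..<length xs}" using calculation(2) by auto
    show "{..<length xs} \<subseteq> g ` set xs"
    proof
      fix i assume "i \<in> {..<length xs}"
      then show "i \<in> g ` set xs" using g[of i] by (intro image_eqI[of _ _ "xs ! i"]) auto
    qed
  qed
  ultimately show ?thesis using that by blast
qed

lemma Perm_inverse:
  assumes "\<sigma> \<in> Perm k"
  obtains \<tau> where "\<tau> \<in> Perm k" "fcomp \<sigma> \<tau> = fid k" "fcomp \<tau> \<sigma> = fid k"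
proof -
  have s: "length \<sigma> = k" "set \<sigma> = {..<k}" "distinct \<sigma>"
    using assms by (auto simp: Smor_def Imor_def Fmor_def)
  obtain g where g1: "\<And>i. i < k \<Longrightarrow> g (\<sigma> ! i) = i"
    and g2: "\<And>j. j < k \<Longrightarrow> g j < k \<and> \<sigma> ! g j = j" and g3: "g ` {..<k} = {..<k}"
    using distinct_nth_inverse[OF s(3)] s(1,2) by (metis lessThan_iff)
  have 1: "fcomp \<sigma> (map g [0..<k]) = fid k"
    using g2 by (auto simp: fcomp_def fid_def intro: map_idI)
  have 2: "fcomp (map g [0..<k]) \<sigma> = fid k"
  proof (rule nth_equalityI)
    fix i assume "i < length (fcomp (map g [0..<k]) \<sigma>)"
    then have "i < k" "\<sigma> ! i < k" using s nth_mem[of i \<sigma>] by (auto simp: fcomp_def)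
    then show "fcomp (map g [0..<k]) \<sigma> ! i = fid k ! i" using g1 s by (simp add: fcomp_def fid_def)
  qed (simp add: s fcomp_def fid_def)
  have "inj_on g {..<k}"
    using g2 by (intro inj_on_inverseI[of _ "(!) \<sigma>"]) auto
  then have "map g [0..<k] \<in> Perm k"
    using g3 by (auto simp: Smor_def Imor_def Fmor_def distinct_map atLeast0LessThan)
  then show ?thesis using that 1 2 by blast
qed

text \<open>\<open>f\<close> enumerates the image of \<open>\<phi>\<close> in increasing order, and
  \<open>p\<close> sends each position to the index of its value in \<open>f\<close>.\<close>

lemma image_factorization:
  assumes "\<phi> \<in> Fmor k m"
  obtains l f p where "p \<in> Smor k l" "f \<in> Imor l m" "\<phi> = fcomp f p"
proof -
  define f where "f = sorted_list_of_set (set \<phi>)"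
  have f: "distinct f" "set f = set \<phi>" by (auto simp: f_def)
  obtain g where g2: "\<And>j. j \<in> set \<phi> \<Longrightarrow> f ! g j = j" and g3: "g ` set \<phi> = {..<length f}"
    using distinct_nth_inverse[OF f(1)] unfolding f(2) by metis
  have "map g \<phi> \<in> Smor k (length f)"
    using assms g3 by (auto simp: Smor_def Fmor_def)
  moreover have "f \<in> Imor (length f) m"
    using f assms by (auto simp: Imor_def Fmor_def)
  moreover have "\<phi> = fcomp f (map g \<phi>)"
    using g2 by (simp add: fcomp_def map_idI)
  ultimately show ?thesis using that by blast
qed

lemma nth_image_lessThan: "(!) xs ` {..<length xs} = set xs"
  using set_map[of "(!) xs" "[0..<length xs]"] by (simp add: map_nth atLeast0LessThan)

text \<open>Both injections enumerate the image of the same function, so \<open>\<sigma>\<close> can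
  be taken as \<open>f\<close> followed by the inverse of \<open>f'\<close>. Injectivity of
  \<open>f'\<close> then cancels it from the equation and leaves
  \<open>p' = fcomp \<sigma> p\<close>.\<close>

lemma image_factorization_unique:
  assumes "p \<in> Smor k l" "f \<in> Imor l m" "p' \<in> Smor k l'" "f' \<in> Imor l' m"
    and eq: "fcomp f p = fcomp f' p'"
  obtains \<sigma> where "\<sigma> \<in> Smor l l'" "\<sigma> \<in> Imor l l'" "l = l'" "f = fcomp f' \<sigma>" "p' = fcomp \<sigma> p"
proof -
  have p: "length p = k" "set p = {..<l}" and p': "length p' = k" "set p' = {..<l'}"
    and f: "length f = l" "distinct f" "set f \<subseteq> {..<m}"
    and f': "length f' = l'" "distinct f'" "set f' \<subseteq> {..<m}"
    using assms by (auto simp: Smor_def Imor_def Fmor_def)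
  have e: "f ! (p ! i) = f' ! (p' ! i)" if "i < k" for i
    using that arg_cong[OF eq, of "\<lambda>xs. xs ! i"] p p' by (auto simp: fcomp_def)
  have "set (map ((!) f) p) = set (map ((!) f') p')" using eq by (simp add: fcomp_def)
  moreover have "set (map ((!) f) p) = set f" "set (map ((!) f') p') = set f'"
    using p p' f f' nth_image_lessThan[of f] nth_image_lessThan[of f'] by simp_all
  ultimately have sets: "set f = set f'" by simp
  have ll: "l = l'" using sets f f' by (metis distinct_card)
  obtain g where g1: "\<And>i. i < l' \<Longrightarrow> g (f' ! i) = i"
    and g2: "\<And>j. j \<in> set f \<Longrightarrow> g j < l' \<and> f' ! g j = j" and g3: "g ` set f = {..<l'}"
    using distinct_nth_inverse[OF f'(2)] f'(1) unfolding sets by metis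
  define \<sigma> where "\<sigma> = map g f"
  have fs: "f = fcomp f' \<sigma>" using g2 by (simp add: fcomp_def \<sigma>_def map_idI)
  have I: "\<sigma> \<in> Imor l l'"
    using g2 f by (auto simp: \<sigma>_def Imor_def Fmor_def distinct_map intro!: inj_on_inverseI[of _ "(!) f'"])
  have S: "\<sigma> \<in> Smor l l'" using f g3 by (auto simp: \<sigma>_def Smor_def Fmor_def)
  have "p' = fcomp \<sigma> p"
  proof (rule nth_equalityI)
    fix i assume "i < length p'"
    then have i: "i < k" "p ! i < l" "p' ! i < l'" using p p' nth_mem[of i p] nth_mem[of i p'] by auto
    then show "p' ! i = fcomp \<sigma> p ! i" using e[of i] g1[of "p' ! i"] p f by (simp add: fcomp_def \<sigma>_def)
  qed (simp add: p p' fcomp_def)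
  then show ?thesis using that S I ll fs by blast
qed

section \<open>The operation \<open>star\<close> and its laws\<close>

lemma star_concat: "star ls \<psi>s \<phi> = concat (map (\<lambda>i. map ((+) (sum_list (take i ls))) (\<psi>s ! i)) \<phi>)"
  by (simp add: star_def)

lemma length_star: "length (star ls \<psi>s \<phi>) = sum_list (map (\<lambda>i. length (\<psi>s ! i)) \<phi>)"
  by (simp add: star_def length_concat comp_def)

text \<open>The domain adds up \<open>ks\<close> along \<open>\<phi>\<close>, with repetitions;
  \<open>ks\<close> is a function because only its values below \<open>length ls\<close> are
  constrained.\<close>

lemma star_Fmor:
  assumes "\<phi> \<in> Fmor n (length ls)" "\<And>i. i < length ls \<Longrightarrow> \<psi>s ! i \<in> Fmor (ks i) (ls ! i)"
  shows "star ls \<psi>s \<phi> \<in> Fmor (sum_list (map ks \<phi>)) (sum_list ls)"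
proof -
  have "map (\<lambda>i. length (\<psi>s ! i)) \<phi> = map ks \<phi>"
    using assms by (auto simp: Fmor_def subset_iff)
  moreover have "set (star ls \<psi>s \<phi>) \<subseteq> {..<sum_list ls}"
  proof
    fix x assume "x \<in> set (star ls \<psi>s \<phi>)"
    then obtain i r where "i \<in> set \<phi>" "r \<in> set (\<psi>s ! i)" "x = sum_list (take i ls) + r"
      by (auto simp: star_def)
    moreover from this have "i < length ls" using assms(1) by (auto simp: Fmor_def)
    moreover from this have "r < ls ! i" using assms(2)[of i] calculation by (auto simp: Fmor_def)
    ultimately show "x \<in> {..<sum_list ls}" using offset_less by auto
  qed
  ultimately show ?thesis unfolding Fmor_def by (metis (mono_tags, lifting) length_star mem_Collect_eq)
qed

lemma star_Smor:
  assumes "\<phi> \<in> Smor n (length ls)" "\<And>i. i < length ls \<Longrightarrow> \<psi>s ! i \<in> Smor (ks i) (ls ! i)"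
  shows "star ls \<psi>s \<phi> \<in> Smor (sum_list (map ks \<phi>)) (sum_list ls)"
proof -
  have F: "star ls \<psi>s \<phi> \<in> Fmor (sum_list (map ks \<phi>)) (sum_list ls)"
    using assms by (intro star_Fmor) (auto intro: Smor_Fmor)
  moreover have "x \<in> set (star ls \<psi>s \<phi>)" if x: "x < sum_list ls" for x
  proof -
    obtain i r where ir: "i < length ls" "r < ls ! i" "x = sum_list (take i ls) + r"
      using offset_cases[OF x] by blast
    then have "i \<in> set \<phi>" "r \<in> set (\<psi>s ! i)" using assms(1) assms(2)[of i] by (auto simp: Smor_def)
    then show ?thesis using ir by (auto simp: star_def)
  qed
  ultimately show ?thesis by (auto simp: Smor_def Fmor_def)
qed

text \<open>Each value \<open>i\<close> of \<open>\<phi>\<close> contributes a block inside the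
  \<open>i\<close>-th interval of the codomain. Blocks of different values are disjoint by
  \<open>offset_inject\<close>, and inside a block \<open>\<psi>s ! i\<close> is injective.\<close>

lemma star_Imor:
  assumes "\<phi> \<in> Imor n (length ls)" "\<And>i. i < length ls \<Longrightarrow> \<psi>s ! i \<in> Imor (ks i) (ls ! i)"
  shows "star ls \<psi>s \<phi> \<in> Imor (sum_list (map ks \<phi>)) (sum_list ls)"
proof -
  have F: "star ls \<psi>s \<phi> \<in> Fmor (sum_list (map ks \<phi>)) (sum_list ls)"
    using assms by (intro star_Fmor) (auto intro: Imor_Fmor)
  have "distinct (star ls \<psi>s \<phi>)"
    if "distinct \<phi>" "set \<phi> \<subseteq> {..<length ls}" using that
  proof (induction \<phi>)
    case (Cons i \<phi>)
    have i: "i < length ls" using Cons.prems by auto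
    have d: "\<psi>s ! i \<in> Imor (ks i) (ls ! i)" using assms(2) i by auto
    have False if "r \<in> set (\<psi>s ! i)" "j \<in> set \<phi>" "s \<in> set (\<psi>s ! j)"
      "sum_list (take i ls) + r = sum_list (take j ls) + s" for r j s
    proof -
      have j: "j < length ls" using Cons.prems that by auto
      have "r < ls ! i" "s < ls ! j" using d that assms(2)[OF j] by (auto simp: Imor_def Fmor_def)
      then show False using offset_inject[OF that(4) i j] Cons.prems that by auto
    qed
    then show ?case using Cons d by (auto simp: star_def distinct_map Imor_def)
  qed (simp add: star_def)
  then show ?thesis using F assms(1) by (auto simp: Imor_def Fmor_def)
qed

text \<open>An entry of \<open>star\<close> is the offset of a block plus a position in it, so
  looking it up in a concatenation with these block lengths lands in that block. Both the
  interchange law and the lookup in tables below use this.\<close>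

lemma map_concat_star:
  assumes "map length xss = ks" "\<And>i. i \<in> set f \<Longrightarrow> i < length xss \<and> set (gs ! i) \<subseteq> {..<length (xss ! i)}"
  shows "map ((!) (concat xss)) (star ks gs f) = concat (map (\<lambda>i. map ((!) (xss ! i)) (gs ! i)) f)"
  unfolding star_def map_concat assms(1)[symmetric]
  using assms(2) by (auto intro!: arg_cong[where f = concat] nth_concat_offset simp: subset_iff)

text \<open>This is the interchange law \<open>(\<langle>\<psi>\<^sub>i\<rangle> \<star> \<phi>) \<circ> (\<langle>g\<^bsub>\<phi>(j)\<^esub>\<rangle> \<star> f) = \<langle>\<psi>\<^sub>i \<circ> g\<^sub>i\<rangle> \<star> (\<phi> \<circ> f)\<close>.\<close>

lemma fcomp_star:
  assumes "\<phi> \<in> Fmor n m" "f \<in> Fmor k n"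
    and "\<And>i. i < m \<Longrightarrow> length (\<psi>s ! i) = ks i" "\<And>i. i < m \<Longrightarrow> gs i \<in> Fmor (ps i) (ks i)"
  shows "fcomp (star ls \<psi>s \<phi>) (star (map ks \<phi>) (map gs \<phi>) f) =
    star ls (map (\<lambda>i. fcomp (\<psi>s ! i) (gs i)) [0..<m]) (fcomp \<phi> f)"
proof -
  have \<phi>: "\<phi> ! i < m" "length \<phi> = n" if "i < n" for i using Fmor_nth[OF assms(1)] Fmor_length[OF assms(1)] that by auto
  have f: "i < n" if "i \<in> set f" for i using assms(2) that by (auto simp: Fmor_def)
  have l: "length \<phi> = n" "set \<phi> \<subseteq> {..<m}" using assms(1) by (auto simp: Fmor_def)
  have g: "r < ks i" if "i < m" "r \<in> set (gs i)" for i r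
    using assms(4) that by (auto simp: Fmor_def)
  show ?thesis
    unfolding fcomp_def
    \<comment> \<open>Only the outer \<open>star\<close> is opened: it is a concatenation along
      \<open>\<phi>\<close> with block lengths \<open>map ks \<phi>\<close>, so
      \<open>map_concat_star\<close> evaluates the composite block by block.\<close>
    apply (subst (1) star_concat)
    apply (subst map_concat_star)
    subgoal using assms(3) l by auto
    subgoal using \<phi> f assms(3) g l by auto
    subgoal using \<phi> f assms(3) g l by (auto simp: star_concat map_concat comp_def intro!: arg_cong[where f = concat])
    done
qed

lemma concat_map_concat: "concat (map concat xsss) = concat (concat xsss)"
  by (induction xsss) auto

text \<open>Associativity of \<open>star\<close>: nesting on the right over the flattened lists
  equals nesting on the left. The offsets agree by \<open>sum_list_take_concat\<close>.\<close>

lemma star_star: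
  assumes "f \<in> Fmor k (length mss)" "\<And>i. i < length mss \<Longrightarrow> gs ! i \<in> Fmor (ks i) (length (mss ! i))"
    and "map length hss = map length mss"
  shows "star (concat mss) (concat hss) (star (map length mss) gs f) =
    star (map sum_list mss) (map (\<lambda>i. star (mss ! i) (hss ! i) (gs ! i)) [0..<length mss]) f"
proof -
  have f: "i < length mss" if "i \<in> set f" for i using assms(1) that by (auto simp: Fmor_def)
  have g: "r < length (mss ! i)" if "i < length mss" "r \<in> set (gs ! i)" for i r
    using assms(2) that by (auto simp: Fmor_def)
  have l: "length hss = length mss" using assms(3) by (metis length_map)
  have h: "length (hss ! i) = length (mss ! i)" if "i < length mss" for i
    using assms(3) that l by (metis nth_map)
  have *: "map (\<lambda>i. map ((+) (sum_list (take i (concat mss)))) (concat hss ! i))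
        (map ((+) (sum_list (take i (map length mss)))) (gs ! i)) =
      map (\<lambda>r. map ((+) (sum_list (take i (map sum_list mss)) + sum_list (take r (mss ! i)))) (hss ! i ! r)) (gs ! i)"
    if "i \<in> set f" for i
    using f[OF that] g[of i] h[of i] l nth_concat_offset(2)[of i hss] assms(3)
    by (auto simp: sum_list_take_concat less_imp_le)
  have "star (concat mss) (concat hss) (star (map length mss) gs f) =
    concat (concat (map (\<lambda>i. map (\<lambda>i. map ((+) (sum_list (take i (concat mss)))) (concat hss ! i))
        (map ((+) (sum_list (take i (map length mss)))) (gs ! i))) f))"
    by (simp add: star_def map_concat comp_def)
  also have "\<dots> = concat (map concat (map (\<lambda>i.
      map (\<lambda>r. map ((+) (sum_list (take i (map sum_list mss)) + sum_list (take r (mss ! i)))) (hss ! i ! r)) (gs ! i)) f))"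
    unfolding concat_map_concat using * by (metis (no_types, lifting) map_cong)
  also have "\<dots> = star (map sum_list mss) (map (\<lambda>i. star (mss ! i) (hss ! i) (gs ! i)) [0..<length mss]) f"
    using f by (auto simp: star_def map_concat comp_def add.assoc intro!: arg_cong[where f = concat])
  finally show ?thesis .
qed

text \<open>For the left unit law: all summands have length 1, so the offset of summand
  \<open>i\<close> is \<open>i\<close> itself.\<close>

lemma star_units:
  assumes "\<phi> \<in> Fmor k n"
  shows "star (replicate n 1) (replicate n (fid 1)) \<phi> = \<phi>"
proof -
  have "star (replicate n 1) (replicate n (fid 1)) \<phi> = concat (map (\<lambda>i. [i]) \<phi>)"
    unfolding star_def fid_def using assms
    by (intro arg_cong[where f = concat]) (auto simp: Fmor_def sum_list_replicate min_def)
  then show ?thesis by simp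
qed

text \<open>This makes the inclusion of \<open>a\<close> as \<open>[1, a]\<close> compatible with
  multiplication.\<close>

lemma star_fid: "star ns (map (\<lambda>i. fid (ns ! i)) [0..<length ns]) (fid (length ns)) = fid (sum_list ns)"
proof (rule nth_equalityI)
  have l: "map length (map (\<lambda>i. map ((+) (sum_list (take i ns))) (fid (ns ! i))) [0..<length ns]) = ns"
    by (intro nth_equalityI) (auto simp: fid_def)
  have s: "star ns (map (\<lambda>i. fid (ns ! i)) [0..<length ns]) (fid (length ns)) =
    concat (map (\<lambda>i. map ((+) (sum_list (take i ns))) (fid (ns ! i))) [0..<length ns])"
    by (auto simp: star_def fid_def intro!: arg_cong[where f = concat])
  then show "length (star ns (map (\<lambda>i. fid (ns ! i)) [0..<length ns]) (fid (length ns))) = length (fid (sum_list ns))"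
    by (simp only: length_concat l) (simp add: fid_def)
  fix x assume "x < length (star ns (map (\<lambda>i. fid (ns ! i)) [0..<length ns]) (fid (length ns)))"
  then have "x < sum_list ns" unfolding s by (simp only: length_concat l)
  then obtain i r where ir: "i < length ns" "r < ns ! i" "x = sum_list (take i ns) + r"
    by (rule offset_cases)
  then show "star ns (map (\<lambda>i. fid (ns ! i)) [0..<length ns]) (fid (length ns)) ! x = fid (sum_list ns) ! x"
    using nth_concat_offset(2)[of i "map (\<lambda>i. map ((+) (sum_list (take i ns))) (fid (ns ! i))) [0..<length ns]" r]
      offset_less[OF ir(1,2)]
    unfolding s l by (simp add: fid_def)
qed

section \<open>Categories of equational theories\<close>

lemma terms_App_iff: "App s ts \<in> terms L n \<longleftrightarrow> s \<in> L (length ts) \<and> set ts \<subseteq> terms L n"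
  by (auto intro: terms.intros elim: terms.cases)

lemma terms_Var_iff [simp]: "Var i \<in> terms L n \<longleftrightarrow> i < n"
  by (auto intro: terms.intros elim: terms.cases)

lemma vars_terms: "t \<in> terms L n \<Longrightarrow> vars t \<subseteq> {..<n}"
  by (induction rule: terms.induct) auto

lemma subst_cong: "(\<And>i. i \<in> vars t \<Longrightarrow> \<sigma> i = \<tau> i) \<Longrightarrow> subst \<sigma> t = subst \<tau> t"
  by (induction t) auto

lemma subst_cong_terms: "t \<in> terms L n \<Longrightarrow> (\<And>i. i < n \<Longrightarrow> \<sigma> i = \<tau> i) \<Longrightarrow> subst \<sigma> t = subst \<tau> t"
  using vars_terms[of t L n] by (intro subst_cong) auto

lemma subst_subst: "subst \<sigma> (subst \<tau> t) = subst (\<lambda>i. subst \<sigma> (\<tau> i)) t"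
  by (induction t) auto

lemma subst_Var [simp]: "subst Var t = t"
  by (induction t) (auto intro: map_idI)

lemma subst_terms: "t \<in> terms L n \<Longrightarrow> (\<And>i. i < n \<Longrightarrow> \<sigma> i \<in> terms L m) \<Longrightarrow> subst \<sigma> t \<in> terms L m"
  by (induction rule: terms.induct) (auto simp: terms_App_iff)

lemma vars_subst: "vars (subst \<sigma> t) = (\<Union>i \<in> vars t. vars (\<sigma> i))"
  by (induction t) auto

lemma provable_terms:
  assumes "eq_theory T" "provable T n s t"
  shows "s \<in> terms (Sym T) n \<and> t \<in> terms (Sym T) n"
  using assms(2)
proof (induction rule: provable.induct)
  case (axiom n s t)
  then show ?case using assms(1) by (auto simp: eq_theory_def)
next
  case (cong f ss ts n)
  then show ?case by (auto simp: terms_App_iff set_conv_nth)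
qed (auto intro: subst_terms)

lemma provable_subst_pointwise:
  assumes "t \<in> terms (Sym T) n" "\<And>i. i < n \<Longrightarrow> provable T m (\<sigma> i) (\<tau> i)"
  shows "provable T m (subst \<sigma> t) (subst \<tau> t)"
  using assms(1)
proof (induction rule: terms.induct)
  case (App s ts)
  then show ?case by (auto intro!: provable.cong)
qed (use assms(2) in auto)

lemma provable_subst_subst:
  assumes T: "eq_theory T" and st: "provable T n s t" and \<sigma>: "\<And>i. i < n \<Longrightarrow> provable T m (\<sigma> i) (\<tau> i)"
  shows "provable T m (subst \<sigma> s) (subst \<tau> t)"
proof (rule provable.trans)
  show "provable T m (subst \<sigma> s) (subst \<sigma> t)"
    using st \<sigma> provable_terms[OF T] by (intro provable.subst) auto
  show "provable T m (subst \<sigma> t) (subst \<tau> t)"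
    using st \<sigma> provable_terms[OF T] by (intro provable_subst_pointwise) auto
qed

section \<open>Interpretations and their extension to terms\<close>

text \<open>The typing half of being an interpretation, split off because the behaviour of
  \<open>extend\<close> on terms depends on typing alone and not on the axioms.\<close>

definition symbol_map :: "'s eqthy \<Rightarrow> 's eqthy \<Rightarrow> 's intp \<Rightarrow> bool"
  where "symbol_map T T' I \<longleftrightarrow> (\<forall>n. \<forall>s \<in> Sym T n. I n s \<in> terms (Sym T') n)"

lemma symbol_mapD: "symbol_map T T' I \<Longrightarrow> s \<in> Sym T n \<Longrightarrow> I n s \<in> terms (Sym T') n"
  by (auto simp: symbol_map_def)

lemma extend_terms:
  assumes I: "symbol_map T T' I" and "t \<in> terms (Sym T) n"
  shows "extend I t \<in> terms (Sym T') n"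
  using assms(2)
proof (induction rule: terms.induct)
  case (App s ts)
  then show ?case using symbol_mapD[OF I, of s "length ts"]
    by (auto intro!: subst_terms[of _ "Sym T'" "length ts"])
qed simp

text \<open>Well-formedness matters here: the value of \<open>I\<close> at a symbol is instantiated
  by indexing a list of arguments, which determines the substitution below \<open>length ts\<close>
  only.\<close>

lemma extend_subst:
  assumes I: "symbol_map T T' I" and "t \<in> terms (Sym T) n"
  shows "extend I (subst \<sigma> t) = subst (\<lambda>i. extend I (\<sigma> i)) (extend I t)"
  using assms(2)
proof (induction rule: terms.induct)
  case (App s ts)
  have "I (length ts) s \<in> terms (Sym T') (length ts)" using App I by (auto intro: symbol_mapD)
  then show ?case using App
    by (auto simp: subst_subst intro!: subst_cong_terms)
qed simp

lemma interpretations_iff: "I \<in> interpretations T T' \<longleftrightarrow> symbol_map T T' I \<and>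
    (\<forall>(n, s, t) \<in> Ax T. provable T' n (extend I s) (extend I t))"
  by (auto simp: interpretations_def symbol_map_def)

text \<open>Soundness of interpretations by induction on derivations; the substitution rule is the
  case that relies on \<open>extend_subst\<close>.\<close>

lemma extend_provable:
  assumes T: "eq_theory T" and T': "eq_theory T'" and I: "I \<in> interpretations T T'"
    and "provable T n s t"
  shows "provable T' n (extend I s) (extend I t)"
  using assms(4)
proof (induction rule: provable.induct)
  case (axiom n s t)
  then show ?case using I by (auto simp: interpretations_iff)
next
  case (refl t n)
  then show ?case using I extend_terms[of T T' I t n]
    by (auto simp: interpretations_iff intro!: provable.refl)
next
  case (cong f ss ts n)
  then show ?case using I symbol_mapD[of T T' I f "length ss"]
    by (auto simp: interpretations_iff intro!: provable_subst_pointwise[of _ _ "length ss"])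
next
  case (subst n s t \<sigma> m)
  have "s \<in> terms (Sym T) n" "t \<in> terms (Sym T) n" using provable_terms[OF T subst.hyps(1)] by auto
  moreover have sm: "symbol_map T T' I" using I by (auto simp: interpretations_iff)
  ultimately show ?case
    using subst extend_terms[OF sm] by (auto simp: extend_subst[OF sm] intro!: provable.subst)
qed (auto intro: provable.intros)

lemma extend_pointwise:
  assumes T': "eq_theory T'"
    and I: "symbol_map T T' I"
    and IJ: "\<And>n s. s \<in> Sym T n \<Longrightarrow> provable T' n (I n s) (J n s)"
    and t: "t \<in> terms (Sym T) n"
  shows "provable T' n (extend I t) (extend J t)"
  using t
proof (induction rule: terms.induct)
  case (App s ts)
  then show ?case by (auto intro!: provable_subst_subst[OF T'] IJ)
qed (auto intro: provable.refl)

lemma generic_terms: "s \<in> Sym T n \<Longrightarrow> generic n s \<in> terms (Sym T) n"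
  by (auto simp: generic_def terms_App_iff)

lemma vars_generic: "vars (generic n s) = {..<n}"
  by (auto simp: generic_def)

lemma subst_generic: "length ts = n \<Longrightarrow> subst (\<lambda>i. ts ! i) (generic n s) = App s ts"
  by (auto simp: generic_def comp_def intro: nth_equalityI)

lemma extend_generic [simp]: "extend generic t = t"
proof (induction t)
  case (App s ts)
  then show ?case by (simp add: subst_generic map_idI)
qed simp

lemma extend_generic_symbol:
  assumes "I n s \<in> terms L n"
  shows "extend I (generic n s) = I n s"
  using subst_cong_terms[OF assms, of "\<lambda>i. map (extend I) (map Var [0..<n]) ! i" Var]
  by (simp add: generic_def)

lemma generic_interpretation: "eq_theory T \<Longrightarrow> generic \<in> interpretations T T"
  by (auto simp: interpretations_iff symbol_map_def generic_terms intro: provable.axiom)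

lemma intp_class_self:
  "I \<in> interpretations T T' \<Longrightarrow> I \<in> intp_class T T' I"
  by (auto simp: intp_class_def interpretations_iff symbol_map_def intro: provable.refl)

text \<open>Equality of arrows of \<open>ET\<close> is reduced here to provable equations between
  the values at symbols; the equations between arrows below come down to this.\<close>

lemma intp_class_eqI:
  assumes "\<And>n s. s \<in> Sym T n \<Longrightarrow> provable T' n (I n s) (J n s)"
  shows "intp_class T T' I = intp_class T T' J"
  using assms unfolding intp_class_def by (blast intro: provable.sym provable.trans)

lemma extend_extend:
  assumes J: "symbol_map T' T'' J" and I: "symbol_map T T' I" and "t \<in> terms (Sym T) n"
  shows "extend J (extend I t) = extend (\<lambda>n s. extend J (I n s)) t"
  using assms(3)
proof (induction rule: terms.induct)
  case (App s ts)
  have It: "I (length ts) s \<in> terms (Sym T') (length ts)" using App I by (auto intro: symbol_mapD)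
  have "extend J (I (length ts) s) \<in> terms (Sym T'') (length ts)" using extend_terms[OF J It] .
  then show ?case using App
    by (auto simp: extend_subst[OF J It] intro!: subst_cong_terms)
qed simp

lemma comp_interpretation:
  assumes T: "eq_theory T" and T': "eq_theory T'" and T'': "eq_theory T''"
    and I: "I \<in> interpretations T T'" and J: "J \<in> interpretations T' T''"
  shows "(\<lambda>n s. extend J (I n s)) \<in> interpretations T T''"
proof -
  have sI: "symbol_map T T' I" and sJ: "symbol_map T' T'' J"
    using I J by (auto simp: interpretations_iff)
  have "provable T'' n (extend (\<lambda>n s. extend J (I n s)) s) (extend (\<lambda>n s. extend J (I n s)) t)"
    if "(n, s, t) \<in> Ax T" for n s t
  proof -
    have st: "s \<in> terms (Sym T) n" "t \<in> terms (Sym T) n" using T that by (auto simp: eq_theory_def)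
    have "provable T' n (extend I s) (extend I t)" using I that by (auto simp: interpretations_iff)
    from extend_provable[OF T' T'' J this] show ?thesis
      using extend_extend[OF sJ sI] st by auto
  qed
  then show ?thesis
    using extend_terms[OF sJ] sI by (auto simp: interpretations_iff symbol_map_def)
qed

section \<open>The categories of theories\<close>

lemma ET_simps: "Ob ET = {T. eq_theory T}" "Hom ET T T' = intp_class T T' ` interpretations T T'"
  "Ident ET T = intp_class T T generic"
  "Cmp ET T T' T'' d c = (\<Union>I \<in> c. \<Union>J \<in> d. intp_class T T'' (\<lambda>n s. extend J (I n s)))"
  by (simp_all add: ET_def)

text \<open>\<open>Cmp ET\<close> is a union over all pairs of representatives; all the classes in
  this union coincide, so any one pair computes the composite.\<close>

lemma Cmp_ET_class:
  assumes T': "eq_theory T'" and T'': "eq_theory T''"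
    and I: "I \<in> interpretations T T'" and J: "J \<in> interpretations T' T''"
  shows "Cmp ET T T' T'' (intp_class T' T'' J) (intp_class T T' I) =
    intp_class T T'' (\<lambda>n s. extend J (I n s))"
proof -
  have "intp_class T T'' (\<lambda>n s. extend J' (I' n s)) = intp_class T T'' (\<lambda>n s. extend J (I n s))"
    if I': "I' \<in> intp_class T T' I" and J': "J' \<in> intp_class T' T'' J" for I' J'
  proof (rule intp_class_eqI)
    fix n s assume s: "s \<in> Sym T n"
    have "provable T' n (I n s) (I' n s)" using I' s by (auto simp: intp_class_def)
    \<comment> \<open>First \<open>I\<close> is exchanged under a fixed \<open>J\<close>, by
      soundness of \<open>J\<close>; then \<open>J\<close> is exchanged symbol by symbol inside a
      fixed term.\<close>
    then have "provable T'' n (extend J (I n s)) (extend J (I' n s))"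
      using extend_provable T' T'' J by blast
    moreover have "provable T'' n (extend J (I' n s)) (extend J' (I' n s))"
      using J' I' J s
      by (intro extend_pointwise[OF T'', of T'])
        (auto simp: intp_class_def interpretations_iff intro: symbol_mapD)
    ultimately show "provable T'' n (extend J' (I' n s)) (extend J (I n s))"
      by (meson provable.sym provable.trans)
  qed
  then show ?thesis
    using intp_class_self[OF I] intp_class_self[OF J] unfolding ET_simps by blast
qed

lemma category_ET: "category (ET :: 's eqthy_cat)"
proof
  fix X Y Z :: "'s eqthy" and f g
  assume "X \<in> Ob ET" "Y \<in> Ob ET" "Z \<in> Ob ET" "f \<in> Hom ET X Y" "g \<in> Hom ET Y Z"
  then show "Cmp ET X Y Z g f \<in> Hom ET X Z"
    by (auto simp: ET_simps(1,2) Cmp_ET_class comp_interpretation)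
next
  fix X Y :: "'s eqthy" and f
  assume "X \<in> Ob ET" "Y \<in> Ob ET" "f \<in> Hom ET X Y"
  then obtain I where *: "eq_theory X" "eq_theory Y" "I \<in> interpretations X Y" "f = intp_class X Y I"
    by (auto simp: ET_simps)
  show "Cmp ET X X Y f (Ident ET X) = f"
  proof -
    have "I n s \<in> terms (Sym Y) n" if "s \<in> Sym X n" for n s
      using * that by (auto simp: interpretations_def)
    then have "provable Y n (extend I (generic n s)) (I n s)" if "s \<in> Sym X n" for n s
      using that by (metis provable.refl extend_generic_symbol)
    then show ?thesis
      using * by (auto simp: ET_simps(3) Cmp_ET_class generic_interpretation intro!: intp_class_eqI)
  qed
  show "Cmp ET X Y Y (Ident ET Y) f = f"
    using * by (auto simp: ET_simps(3) Cmp_ET_class generic_interpretation)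
next
  fix W X Y Z :: "'s eqthy" and f g h
  assume "W \<in> Ob ET" "X \<in> Ob ET" "Y \<in> Ob ET" "Z \<in> Ob ET"
    "f \<in> Hom ET W X" "g \<in> Hom ET X Y" "h \<in> Hom ET Y Z"
  then obtain I J K where *: "eq_theory W" "eq_theory X" "eq_theory Y" "eq_theory Z"
    "I \<in> interpretations W X" "f = intp_class W X I" "J \<in> interpretations X Y" "g = intp_class X Y J"
    "K \<in> interpretations Y Z" "h = intp_class Y Z K"
    by (auto simp: ET_simps)
  then have **: "symbol_map W X I" "symbol_map X Y J" "symbol_map Y Z K"
    by (auto simp: interpretations_iff)
  have "extend K (extend J (I n s)) = extend (\<lambda>n s. extend K (J n s)) (I n s)" if "s \<in> Sym W n" for n s
    using extend_extend[OF **(3,2)] ** that by (auto intro: symbol_mapD)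
  moreover have "provable Z n (extend K (extend J (I n s))) (extend K (extend J (I n s)))" if "s \<in> Sym W n" for n s
    using ** that by (auto intro!: provable.refl extend_terms intro: symbol_mapD)
  ultimately show "Cmp ET W Y Z h (Cmp ET W X Y g f) = Cmp ET W X Z (Cmp ET X Y Z h g) f"
    using * by (auto simp: Cmp_ET_class comp_interpretation intro!: intp_class_eqI)
next
  fix X :: "'s eqthy" assume "X \<in> Ob ET"
  then show "Ident ET X \<in> Hom ET X X" by (auto simp: ET_simps generic_interpretation)
qed

lemma RegET_simps: "Ob RegET = {T. regular_theory T}"
  "Hom RegET T T' = {c \<in> Hom ET T T'. \<exists>I \<in> c. regular_interpretation T I}"
  "Ident RegET = Ident ET" "Cmp RegET = Cmp ET"
  by (simp_all add: RegET_def)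

lemma regular_eq_theory: "regular_theory T \<Longrightarrow> eq_theory T"
  by (simp add: regular_theory_def)

text \<open>A regular value at a symbol mentions every argument, so no variable gets lost. This
  closes \<open>RegET\<close> under composition.\<close>

lemma vars_extend:
  assumes "symbol_map T T' J" "regular_interpretation T J" "t \<in> terms (Sym T) n"
  shows "vars (extend J t) = vars t"
  using assms(3)
proof (induction rule: terms.induct)
  case (App s ts)
  have "vars (J (length ts) s) = {..<length ts}"
    using App assms(2) by (auto simp: regular_interpretation_def)
  then have "vars (extend J (App s ts)) = (\<Union>i<length ts. vars (extend J (ts ! i)))"
    by (simp add: vars_subst)
  also have "\<dots> = (\<Union>t \<in> set ts. vars t)"
    using App by (force simp: set_conv_nth)
  finally show ?case by simp
qed simp

lemma category_RegET: "category (RegET :: 's eqthy_cat)"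
proof
  interpret E: category "ET :: 's eqthy_cat" by (rule category_ET)
  { fix X Y Z :: "'s eqthy" and f g
    assume X: "X \<in> Ob RegET" "Y \<in> Ob RegET" "Z \<in> Ob RegET" and f: "f \<in> Hom RegET X Y" and g: "g \<in> Hom RegET Y Z"
    obtain I J where I: "I \<in> f" "regular_interpretation X I" and J: "J \<in> g" "regular_interpretation Y J"
      using f g by (auto simp: RegET_simps)
    have IJ: "I \<in> interpretations X Y" "J \<in> interpretations Y Z"
      using I J f g by (auto simp: RegET_simps ET_simps intp_class_def)
    let ?K = "\<lambda>n s. extend J (I n s)"
    \<comment> \<open>An arrow of \<open>RegET\<close> is a class with at least one regular member,
      and \<open>?K\<close> is such a member of the composite.\<close>
    have "regular_interpretation X ?K"
      unfolding regular_interpretation_def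
    proof (intro allI ballI)
      fix n s assume s: "s \<in> Sym X n"
      have "I n s \<in> terms (Sym Y) n" using IJ(1) s by (auto simp: interpretations_def)
      then have "vars (extend J (I n s)) = vars (I n s)"
        using vars_extend[OF _ J(2)] IJ by (auto simp: interpretations_iff)
      then show "vars (extend J (I n s)) = {..<n}"
        using I(2) s by (auto simp: regular_interpretation_def)
    qed
    moreover have "?K \<in> Cmp ET X Y Z g f"
      using I J intp_class_self[OF comp_interpretation[OF _ _ _ IJ]] X
      by (auto simp: ET_simps RegET_simps regular_eq_theory)
    ultimately show "Cmp RegET X Y Z g f \<in> Hom RegET X Z"
      using E.Cmp_in_Hom[of X Y Z f g] X f g by (auto simp: RegET_simps ET_simps(1) regular_eq_theory) }
  { fix X :: "'s eqthy" assume X: "X \<in> Ob RegET"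
    have "regular_interpretation X generic" by (simp add: regular_interpretation_def vars_generic)
    then show "Ident RegET X \<in> Hom RegET X X"
      using X intp_class_self[OF generic_interpretation[of X]] E.Ident_in_Hom[of X]
      unfolding RegET_simps ET_simps(1,3) by (blast dest: regular_eq_theory) }
qed (simp_all add: RegET_simps regular_eq_theory ET_simps(1) category.Cmp_Ident_left[OF category_ET]
    category.Cmp_Ident_right[OF category_ET] category.Cmp_assoc[OF category_ET])

lemma functor_P_ef: "is_functor (RegET :: 's eqthy_cat) ET P_ef"
  by (intro is_functor.intro category_RegET category_ET is_functor_axioms.intro)
    (auto simp: P_ef_def RegET_simps ET_simps(1) regular_eq_theory)

section \<open>Operads and their equational theories\<close>

lemma Op_cat_simps: "Ob (Op_cat H) = {\<O>. operad H \<O>}" "Hom (Op_cat H) = operad_hom H"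
  "Ident (Op_cat H) = (\<lambda>\<O> n. \<lambda>a \<in> Ops \<O> n. a)"
  "Cmp (Op_cat H) = (\<lambda>\<O> \<O>' \<O>'' g f n. compose (Ops \<O> n) (g n) (f n))"
  by (simp_all add: Op_cat_def)

abbreviation has_arities :: "'a operad \<Rightarrow> nat list \<Rightarrow> 'a list \<Rightarrow> bool"
  where "has_arities \<O> \<equiv> list_all2 (\<lambda>n b. b \<in> Ops \<O> n)"

lemma operad_homD:
  assumes "h \<in> operad_hom H \<O> \<O>'"
  shows "h n \<in> Ops \<O> n \<rightarrow>\<^sub>E Ops \<O>' n" "h (Suc 0) (iota \<O>) = iota \<O>'"
    "has_arities \<O> ns bs \<Longrightarrow> a \<in> Ops \<O> (length ns) \<Longrightarrow>
      h (sum_list ns) (mul \<O> ns bs a) = mul \<O>' ns (map2 h ns bs) (h (length ns) a)"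
    "\<phi> \<in> H n m \<Longrightarrow> a \<in> Ops \<O> n \<Longrightarrow> h m (act \<O> m \<phi> a) = act \<O>' m \<phi> (h n a)"
  using assms by (auto simp: operad_hom_def)

lemma operad_hom_closed: "h \<in> operad_hom H \<O> \<O>' \<Longrightarrow> a \<in> Ops \<O> n \<Longrightarrow> h n a \<in> Ops \<O>' n"
  using operad_homD(1) by fastforce

lemma has_arities_map2:
  assumes "h \<in> operad_hom H \<O> \<O>'" "has_arities \<O> ns bs"
  shows "has_arities \<O>' ns (map2 h ns bs)"
  using assms(2) by (induction rule: list_all2_induct) (auto intro: operad_hom_closed[OF assms(1)])

lemma has_arities_map2_Ident: "has_arities \<O> ns bs \<Longrightarrow> map2 (\<lambda>n. \<lambda>a \<in> Ops \<O> n. a) ns bs = bs"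
  by (induction rule: list_all2_induct) auto

lemma has_arities_map2_compose: "has_arities \<O> ns bs \<Longrightarrow>
    map2 (\<lambda>n. compose (Ops \<O> n) (g n) (f n)) ns bs = map2 g ns (map2 f ns bs)"
  by (induction rule: list_all2_induct) (auto simp: compose_def)

lemma has_arities_length: "has_arities \<O> ns bs \<Longrightarrow> length bs = length ns"
  by (simp add: list_all2_lengthD)

lemma category_Op_cat: "category (Op_cat H)"
proof
  fix X assume "X \<in> Ob (Op_cat H)"
  then interpret operad H X by (simp add: Op_cat_simps)
  show "Ident (Op_cat H) X \<in> Hom (Op_cat H) X X"
    using iota_closed mul_closed act_closed
    by (auto simp: Op_cat_simps operad_hom_def has_arities_map2_Ident)
next
  fix X Y Z f g assume "X \<in> Ob (Op_cat H)" "Y \<in> Ob (Op_cat H)" "Z \<in> Ob (Op_cat H)"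
    and f: "f \<in> Hom (Op_cat H) X Y" and g: "g \<in> Hom (Op_cat H) Y Z"
  then interpret X: operad H X by (simp add: Op_cat_simps)
  note f = f[unfolded Op_cat_simps] and g = g[unfolded Op_cat_simps]
  have 1: "compose (Ops X n) (g n) (f n) \<in> Ops X n \<rightarrow>\<^sub>E Ops Z n" for n
    using operad_hom_closed[OF f] operad_hom_closed[OF g] by (auto simp: compose_def)
  show "Cmp (Op_cat H) X Y Z g f \<in> Hom (Op_cat H) X Z"
    unfolding Op_cat_simps operad_hom_def mem_Collect_eq
  proof (intro conjI allI impI 1)
    show "compose (Ops X 1) (g 1) (f 1) (iota X) = iota Z"
      using operad_homD(2)[OF f] operad_homD(2)[OF g] X.iota_closed by (simp add: compose_def)
  next
    fix ns bs a assume "has_arities X ns bs \<and> a \<in> Ops X (length ns)"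
    then have *: "has_arities X ns bs" "a \<in> Ops X (length ns)" by auto
    have "compose (Ops X (sum_list ns)) (g (sum_list ns)) (f (sum_list ns)) (mul X ns bs a) =
      g (sum_list ns) (mul Y ns (map2 f ns bs) (f (length ns) a))"
      using * by (simp add: compose_def operad_homD(3)[OF f] X.mul_closed)
    also have "\<dots> = mul Z ns (map2 g ns (map2 f ns bs)) (g (length ns) (f (length ns) a))"
      using * has_arities_map2[OF f] operad_hom_closed[OF f] by (intro operad_homD(3)[OF g]) auto
    finally show "compose (Ops X (sum_list ns)) (g (sum_list ns)) (f (sum_list ns)) (mul X ns bs a) =
      mul Z ns (map2 (\<lambda>n. compose (Ops X n) (g n) (f n)) ns bs)
        (compose (Ops X (length ns)) (g (length ns)) (f (length ns)) a)"
      using * by (simp add: has_arities_map2_compose compose_eq)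
  next
    fix n m \<phi> a assume "\<phi> \<in> H n m \<and> a \<in> Ops X n"
    then have "\<phi> \<in> H n m" "a \<in> Ops X n" by auto
    then show "compose (Ops X m) (g m) (f m) (act X m \<phi> a) = act Z m \<phi> (compose (Ops X n) (g n) (f n) a)"
      using X.act_closed operad_hom_closed[OF f]
      by (simp add: compose_def operad_homD(4)[OF f] operad_homD(4)[OF g])
  qed
next
  fix X Y f assume "f \<in> Hom (Op_cat H) X Y"
  then have f: "f \<in> operad_hom H X Y" by (simp add: Op_cat_simps)
  \<comment> \<open>Both unit laws are equalities of total functions; they hold because the
    components of an arrow are \<open>undefined\<close> outside the carriers.\<close>
  have "compose (Ops X n) (f n) (\<lambda>a \<in> Ops X n. a) = f n"
    "compose (Ops X n) (\<lambda>a \<in> Ops Y n. a) (f n) = f n" for n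
    using operad_homD(1)[OF f, of n] by (auto simp: compose_def PiE_def extensional_def fun_eq_iff Pi_iff)
  then show "Cmp (Op_cat H) X X Y f (Ident (Op_cat H) X) = f"
    "Cmp (Op_cat H) X Y Y (Ident (Op_cat H) Y) f = f"
    by (simp_all add: Op_cat_simps)
next
  fix W X Y Z f g h assume "f \<in> Hom (Op_cat H) W X"
  then have "f \<in> operad_hom H W X" by (simp add: Op_cat_simps)
  from operad_hom_closed[OF this]
  show "Cmp (Op_cat H) W Y Z h (Cmp (Op_cat H) W X Y g f) = Cmp (Op_cat H) W X Z (Cmp (Op_cat H) X Y Z h g) f"
    by (auto simp: Op_cat_simps compose_def fun_eq_iff)
qed

section \<open>The theory of an operad\<close>

text \<open>One locale covers both kinds of action, so that the facts about \<open>E_ob\<close> are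
  proved once for \<open>Fmor\<close> and \<open>Smor\<close>.\<close>

locale fin_operad = operad H \<O> for H and \<O> :: "'a operad" +
  assumes H_Fmor: "\<phi> \<in> H n m \<Longrightarrow> \<phi> \<in> Fmor n m"
begin

abbreviation "E \<equiv> E_ob H \<O>"

lemma Sym_E [simp]: "Sym E = Ops \<O>"
  by (simp add: E_ob_def)

lemma Ax_E_cases:
  assumes "(l, s, t) \<in> Ax E"
  obtains "l = 1" "s = App (iota \<O>) [Var 0]" "t = Var 0"
  | m \<tau> a where "\<tau> \<in> H m l" "a \<in> Ops \<O> m" "s = App a (map Var \<tau>)" "t = generic l (act \<O> l \<tau> a)"
  | ns bs a where "l = sum_list ns" "has_arities \<O> ns bs" "a \<in> Ops \<O> (length ns)"
      "s = App a (map (\<lambda>i. App (bs ! i)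
          (map Var [sum_list (take i ns)..<sum_list (take (Suc i) ns)])) [0..<length ns])"
      "t = generic l (mul \<O> ns bs a)"
  using assms unfolding E_ob_def by auto

lemma Ax_E_iota: "(1, App (iota \<O>) [Var 0], Var 0) \<in> Ax E"
  by (simp add: E_ob_def)

lemma Ax_E_act: "\<tau> \<in> H m n \<Longrightarrow> a \<in> Ops \<O> m \<Longrightarrow>
    (n, App a (map Var \<tau>), generic n (act \<O> n \<tau> a)) \<in> Ax E"
  by (auto simp: E_ob_def)

lemma Ax_E_mul: "has_arities \<O> ns bs \<Longrightarrow> a \<in> Ops \<O> (length ns) \<Longrightarrow>
    (sum_list ns, App a (map (\<lambda>i. App (bs ! i)
      (map Var [sum_list (take i ns)..<sum_list (take (Suc i) ns)])) [0..<length ns]),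
      generic (sum_list ns) (mul \<O> ns bs a)) \<in> Ax E"
  unfolding E_ob_def by auto

lemma eq_theory_E: "eq_theory E"
proof -
  have "s \<in> terms (Ops \<O>) l \<and> t \<in> terms (Ops \<O>) l" if "(l, s, t) \<in> Ax E" for l s t
    using that
  proof (cases rule: Ax_E_cases)
    case 1
    then show ?thesis using iota_closed by (auto simp: terms_App_iff)
  next
    case (2 m \<tau> a)
    then show ?thesis using H_Fmor[OF 2(1)] act_closed[OF 2(1,2)]
      by (auto simp: terms_App_iff Fmor_def generic_def)
  next
    case (3 ns bs a)
    have "x < sum_list ns" if "x < sum_list (take (Suc i) ns)" "i < length ns" for x i
      using that sum_list_take_mono[of "Suc i" "length ns" ns] by auto
    then show ?thesis using 3 mul_closed[of ns bs a]
      by (auto simp: terms_App_iff generic_def list_all2_conv_all_nth sum_list_take_Suc)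
  qed
  then show ?thesis by (auto simp: eq_theory_def)
qed

text \<open>The axioms are stated for the generic variables of a context; a list \<open>ts\<close>
  read as a substitution makes them available for arbitrary arguments.\<close>

lemma provable_instance:
  assumes "provable E n s t" "length ts = n" "set ts \<subseteq> terms (Ops \<O>) l"
  shows "provable E l (subst ((!) ts) s) (subst ((!) ts) t)"
  using assms by (intro provable.subst) (auto simp: set_conv_nth)

lemma provable_iota: "t \<in> terms (Ops \<O>) l \<Longrightarrow> provable E l (App (iota \<O>) [t]) t"
  using provable_instance[OF provable.axiom[OF Ax_E_iota], of "[t]"] by simp

lemma provable_act:
  assumes "\<tau> \<in> H m n" "a \<in> Ops \<O> m" "length ts = n" "set ts \<subseteq> terms (Ops \<O>) l"
  shows "provable E l (App a (map ((!) ts) \<tau>)) (App (act \<O> n \<tau> a) ts)"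
  using provable_instance[OF provable.axiom[OF Ax_E_act[OF assms(1,2)]] assms(3,4)] assms(3)
  by (simp add: subst_generic comp_def)

lemma provable_mul:
  assumes "has_arities \<O> (map length tss) bs" "a \<in> Ops \<O> (length tss)"
    "set (concat tss) \<subseteq> terms (Ops \<O>) l"
  shows "provable E l (App a (map2 App bs tss)) (App (mul \<O> (map length tss) bs a) (concat tss))"
proof -
  have ax: "(sum_list (map length tss), App a (map (\<lambda>i. App (bs ! i)
      (map Var [sum_list (take i (map length tss))..<sum_list (take (Suc i) (map length tss))])) [0..<length (map length tss)]),
      generic (sum_list (map length tss)) (mul \<O> (map length tss) bs a)) \<in> Ax E"
    using assms by (intro Ax_E_mul) auto
  \<comment> \<open>After the substitution, the \<open>i\<close>-th interval of variables has become
    the \<open>i\<close>-th block of arguments.\<close>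
  have "map (\<lambda>i. App (bs ! i) (map ((!) (concat tss))
      [sum_list (take i (map length tss))..<sum_list (take (Suc i) (map length tss))])) [0..<length tss] =
    map2 App bs tss"
    using has_arities_length[OF assms(1)]
    by (intro nth_equalityI) (auto simp: map_nth_concat_slice simp del: take_map)
  then show ?thesis
    using provable_instance[OF provable.axiom[OF ax] _ assms(3)]
    by (simp add: length_concat subst_generic comp_def)
qed

end

abbreviation hom_intp :: "(nat \<Rightarrow> 'a \<Rightarrow> 'a) \<Rightarrow> 'a intp"
  where "hom_intp h \<equiv> (\<lambda>n a. generic n (h n a))"

lemma extend_hom_intp: "extend (hom_intp h) (App a ts) = App (h (length ts) a) (map (extend (hom_intp h)) ts)"
  by (simp add: subst_generic)

lemma extend_hom_intp_generic: "extend (hom_intp h) (generic n a) = generic n (h n a)"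
  unfolding generic_def extend_hom_intp by simp

text \<open>A morphism preserves exactly the data that occur in the axioms, so the image of each
  axiom is literally an axiom of the target.\<close>

lemma hom_intp_interpretation:
  assumes "fin_operad H \<O>" "fin_operad H \<O>'" and h: "h \<in> operad_hom H \<O> \<O>'"
  shows "hom_intp h \<in> interpretations (E_ob H \<O>) (E_ob H \<O>')"
proof -
  interpret O: fin_operad H \<O> by fact
  interpret O': fin_operad H \<O>' by fact
  have "symbol_map O.E O'.E (hom_intp h)"
    using operad_hom_closed[OF h] by (auto simp: symbol_map_def generic_def terms_App_iff)
  moreover have "(l, extend (hom_intp h) s, extend (hom_intp h) t) \<in> Ax O'.E" if "(l, s, t) \<in> Ax O.E" for l s t
    using that
  proof (cases rule: O.Ax_E_cases)
    case 1
    then show ?thesis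
      using O'.Ax_E_iota operad_homD(2)[OF h] unfolding 1 extend_hom_intp by simp
  next
    case (2 m \<tau> a)
    have "length \<tau> = m" using O.H_Fmor[OF 2(1)] by (simp add: Fmor_def)
    moreover have "(l, App (h m a) (map Var \<tau>), generic l (act \<O>' l \<tau> (h m a))) \<in> Ax O'.E"
      using 2 operad_hom_closed[OF h] by (intro O'.Ax_E_act)
    ultimately show ?thesis
      using operad_homD(4)[OF h 2(1,2)] unfolding 2(3,4) extend_hom_intp extend_hom_intp_generic by (simp add: comp_def)
  next
    case (3 ns bs a)
    let ?bs = "map2 h ns bs"
    have l: "length bs = length ns" using 3 has_arities_length by auto
    have "(sum_list ns, App (h (length ns) a) (map (\<lambda>i. App (?bs ! i)
      (map Var [sum_list (take i ns)..<sum_list (take (Suc i) ns)])) [0..<length ns]),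
      generic (sum_list ns) (mul \<O>' ns ?bs (h (length ns) a))) \<in> Ax O'.E"
      using 3 operad_hom_closed[OF h] has_arities_map2[OF h] by (intro O'.Ax_E_mul) auto
    moreover have "extend (hom_intp h) s = App (h (length ns) a) (map (\<lambda>i. App (?bs ! i)
      (map Var [sum_list (take i ns)..<sum_list (take (Suc i) ns)])) [0..<length ns])"
      using l unfolding 3(4) extend_hom_intp by (simp add: extend_hom_intp sum_list_take_Suc comp_def del: extend.simps(2))
    ultimately show ?thesis
      using operad_homD(3)[OF h 3(2,3)] unfolding 3(1,5) extend_hom_intp_generic by simp
  qed
  ultimately show ?thesis
    by (auto simp: interpretations_iff intro: provable.axiom)
qed

lemma E_arr_eq: "E_arr H \<O> \<O>' h = intp_class (E_ob H \<O>) (E_ob H \<O>') (hom_intp h)"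
  by (simp add: E_arr_def)

lemma E_arr_in_Hom:
  assumes "fin_operad H \<O>" "fin_operad H \<O>'" "h \<in> operad_hom H \<O> \<O>'"
  shows "E_arr H \<O> \<O>' h \<in> Hom ET (E_ob H \<O>) (E_ob H \<O>')"
  using hom_intp_interpretation[OF assms] by (auto simp: E_arr_eq ET_simps(2))

lemma E_arr_Ident:
  assumes "fin_operad H \<O>"
  shows "E_arr H \<O> \<O> (\<lambda>n. \<lambda>a \<in> Ops \<O> n. a) = Ident ET (E_ob H \<O>)"
proof -
  interpret fin_operad H \<O> by fact
  show ?thesis
    unfolding E_arr_eq ET_simps(3) by (rule intp_class_eqI) (auto intro!: provable.refl generic_terms)
qed

lemma E_arr_compose:
  assumes "fin_operad H X" "fin_operad H Y" "fin_operad H Z"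
    and f: "f \<in> operad_hom H X Y" and g: "g \<in> operad_hom H Y Z"
  shows "E_arr H X Z (\<lambda>n. compose (Ops X n) (g n) (f n)) =
    Cmp ET (E_ob H X) (E_ob H Y) (E_ob H Z) (E_arr H Y Z g) (E_arr H X Y f)"
proof -
  interpret X: fin_operad H X by fact
  interpret Y: fin_operad H Y by fact
  interpret Z: fin_operad H Z by fact
  have "E_arr H X Z (\<lambda>n. compose (Ops X n) (g n) (f n)) =
    intp_class X.E Z.E (\<lambda>n a. extend (hom_intp g) (generic n (f n a)))"
    unfolding E_arr_eq using operad_hom_closed[OF f] operad_hom_closed[OF g]
    by (intro intp_class_eqI) (auto simp: extend_hom_intp_generic compose_def intro!: provable.refl generic_terms)
  also have "\<dots> = Cmp ET X.E Y.E Z.E (E_arr H Y Z g) (E_arr H X Y f)"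
    unfolding E_arr_eq
    using Cmp_ET_class[OF Y.eq_theory_E Z.eq_theory_E hom_intp_interpretation[OF assms(1,2) f]
        hom_intp_interpretation[OF assms(2,3) g]] by simp
  finally show ?thesis .
qed

lemma fin_operad_Fmor: "operad Fmor \<O> \<Longrightarrow> fin_operad Fmor \<O>"
  by (simp add: fin_operad_def fin_operad_axioms_def)

lemma fin_operad_Smor: "operad Smor \<O> \<Longrightarrow> fin_operad Smor \<O>"
  by (simp add: fin_operad_def fin_operad_axioms_def Smor_Fmor)

lemma functor_E_fo: "is_functor (FOp :: 'a operad_cat) ET E_fo"
proof (intro is_functor.intro is_functor_axioms.intro category_ET)
  show "category (FOp :: 'a operad_cat)" by (simp add: FOp_def category_Op_cat)
qed (auto simp: FOp_def E_fo_def Op_cat_simps ET_simps(1) fin_operad.eq_theory_E[OF fin_operad_Fmor] fin_operad_Fmor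
    E_arr_Ident E_arr_compose E_arr_in_Hom)

text \<open>The given axioms are already a regular set: \<open>\<tau>\<close> is surjective, so it
  mentions the whole context, and the intervals of variables in a multiplication axiom cover the
  context by \<open>offset_cases\<close>.\<close>

lemma regular_theory_E:
  assumes "operad Smor \<O>"
  shows "regular_theory (E_ob Smor \<O>)"
proof -
  interpret fin_operad Smor \<O> using assms by (rule fin_operad_Smor)
  have "vars s = vars t" if "(l, s, t) \<in> Ax E" for l s t
    using that
  proof (cases rule: Ax_E_cases)
    case (2 m \<tau> a)
    then show ?thesis by (auto simp: vars_generic Smor_def)
  next
    case (3 ns bs a)
    have "x < sum_list ns" if "x < sum_list (take i ns) + ns ! i" "i < length ns" for x i
      using that sum_list_take_mono[of "Suc i" "length ns" ns] by (auto simp: sum_list_take_Suc)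
    moreover have "\<exists>i < length ns. sum_list (take i ns) \<le> x \<and> x < sum_list (take i ns) + ns ! i"
      if x: "x < sum_list ns" for x
      using offset_cases[OF x] by (metis le_add1 nat_add_left_cancel_less)
    ultimately show ?thesis unfolding 3
      by (auto simp: vars_generic sum_list_take_Suc Bex_def)
  qed simp
  then show ?thesis
    using eq_theory_E unfolding regular_theory_def by (intro conjI exI[of _ "Ax E"]) auto
qed

lemma functor_E_ro: "is_functor (RegOp :: 'a operad_cat) RegET E_ro"
proof (intro is_functor.intro is_functor_axioms.intro category_RegET)
  show "category (RegOp :: 'a operad_cat)" by (simp add: RegOp_def category_Op_cat)
next
  fix X Y :: "'a operad" and f assume "X \<in> Ob RegOp" "Y \<in> Ob RegOp" "f \<in> Hom RegOp X Y"
  then have *: "operad Smor X" "operad Smor Y" "f \<in> operad_hom Smor X Y"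
    by (auto simp: RegOp_def Op_cat_simps)
  then have "hom_intp f \<in> interpretations (E_ob Smor X) (E_ob Smor Y)"
    by (intro hom_intp_interpretation fin_operad_Smor)
  then show "on_arr E_ro X Y f \<in> Hom RegET (on_ob E_ro X) (on_ob E_ro Y)"
    using intp_class_self[of "hom_intp f"]
    by (auto simp: E_ro_def RegET_simps ET_simps(2) E_arr_eq regular_interpretation_def vars_generic
      intro!: bexI[of _ "hom_intp f"])
qed (auto simp: RegOp_def E_ro_def Op_cat_simps RegET_simps regular_theory_E fin_operad_Smor
    E_arr_Ident E_arr_compose)

section \<open>The functor from regular to full operads\<close>

lemma map_nth_fcomp: "map F (fcomp \<psi> \<phi>) = map (\<lambda>i. F (\<psi> ! i)) \<phi>"
  by (simp add: fcomp_def)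

lemma map_nth_Fmor: "\<phi> \<in> Fmor n m \<Longrightarrow> length xs = m \<Longrightarrow> map ((!) (map F xs)) \<phi> = map (\<lambda>i. F (xs ! i)) \<phi>"
  by (auto simp: Fmor_def)

text \<open>A family indexed by pairs, flattened to the index of a lexicographic sum. In the
  associativity law the representatives of the innermost operations are indexed by pairs, while the
  flattened product wants one index.\<close>

abbreviation table :: "nat list \<Rightarrow> (nat \<Rightarrow> nat \<Rightarrow> 'b) \<Rightarrow> 'b list"
  where "table ls F \<equiv> concat (map (\<lambda>i. map (F i) [0..<ls ! i]) [0..<length ls])"

lemma sum_list_concat_map: "sum_list (concat xss) = sum_list (map sum_list xss)"
  by (induction xss) auto

lemma table_lengths: "map length (map (\<lambda>i. map (F i) [0..<ls ! i]) [0..<length ls]) = ls"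
  by (intro nth_equalityI) auto

lemma length_table: "length (table ls F) = sum_list ls"
  unfolding length_concat table_lengths ..

lemma nth_table: "i < length ls \<Longrightarrow> r < ls ! i \<Longrightarrow> table ls F ! (sum_list (take i ls) + r) = F i r"
  using nth_concat_offset(2)[of i "map (\<lambda>i. map (F i) [0..<ls ! i]) [0..<length ls]" r]
  unfolding table_lengths by simp

lemma map_table_star:
  assumes "set f \<subseteq> {..<length ls}" "\<And>i. i < length ls \<Longrightarrow> set (g i) \<subseteq> {..<ls ! i}"
  shows "map ((!) (table ls F)) (star ls (map g [0..<length ls]) f) = concat (map (\<lambda>i. map (F i) (g i)) f)"
proof -
  have f: "i < length ls" if "i \<in> set f" for i using assms(1) that by auto
  have "map ((!) (table ls F)) (star ls (map g [0..<length ls]) f) =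
      concat (map (\<lambda>i. map ((!) (map (\<lambda>i. map (F i) [0..<ls ! i]) [0..<length ls] ! i)) (map g [0..<length ls] ! i)) f)"
    using assms f by (intro map_concat_star table_lengths) auto
  also have "\<dots> = concat (map (\<lambda>i. map (F i) (g i)) f)"
    using assms(2) f by (auto intro!: arg_cong[where f = concat] simp: subset_iff)
  finally show ?thesis .
qed

context fin_operad
begin

text \<open>The law \<open>mul_act\<close> for families reindexed along a list \<open>f\<close>,
  which is the shape in which the product of classes selects its factors.\<close>

lemma mul_act_map:
  assumes "\<phi> \<in> H n m" "a \<in> Ops \<O> n" "length f = m"
    and "\<And>i. i \<in> set f \<Longrightarrow> q i \<in> H (p i) (r i)" "\<And>i. i \<in> set f \<Longrightarrow> b i \<in> Ops \<O> (p i)"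
  shows "mul \<O> (map r f) (map (\<lambda>i. act \<O> (r i) (q i) (b i)) f) (act \<O> m \<phi> a) =
    act \<O> (sum_list (map r f)) (star (map r f) (map q f) \<phi>)
      (mul \<O> (map p (fcomp f \<phi>)) (map b (fcomp f \<phi>)) a)"
proof -
  have "map (\<lambda>i. act \<O> (map r f ! i) (map q f ! i) (map b f ! i)) [0..<m] =
      map (\<lambda>i. act \<O> (r i) (q i) (b i)) f"
    using assms(3) by (intro nth_equalityI) auto
  then show ?thesis
    using mul_act[of \<phi> n m a "map p f" "map r f" "map q f" "map b f"] assms
    by (simp add: map_nth_fcomp map_nth_Fmor[OF H_Fmor[OF assms(1)]])
qed

text \<open>Associativity in the same reindexed shape.\<close>

lemma mul_assoc_map:
  assumes "a \<in> Ops \<O> (length f)" "\<And>i. i \<in> set f \<Longrightarrow> b i \<in> Ops \<O> (length (ms i))"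
    and "\<And>i. i \<in> set f \<Longrightarrow> has_arities \<O> (ms i) (cs i)"
  shows "mul \<O> (map (\<lambda>i. sum_list (ms i)) f) (map (\<lambda>i. mul \<O> (ms i) (cs i) (b i)) f) a =
    mul \<O> (concat (map ms f)) (concat (map cs f)) (mul \<O> (map (\<lambda>i. length (ms i)) f) (map b f) a)"
proof -
  have "map (\<lambda>i. mul \<O> (map ms f ! i) (map cs f ! i) (map b f ! i)) [0..<length (map ms f)] =
      map (\<lambda>i. mul \<O> (ms i) (cs i) (b i)) f"
    by (intro nth_equalityI) auto
  then show ?thesis
    using mul_assoc[of "map ms f" "map cs f" "map b f" a] assms
    by (simp add: list_all2_conv_all_nth comp_def)
qed

lemma mul_closed_map:
  assumes "\<And>i. i \<in> set f \<Longrightarrow> b i \<in> Ops \<O> (k i)" "a \<in> Ops \<O> (length f)"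
  shows "mul \<O> (map k f) (map b f) a \<in> Ops \<O> (sum_list (map k f))"
  using assms by (intro mul_closed) (auto simp: list_all2_conv_all_nth)

end

section \<open>Tensor classes and their representatives\<close>

locale regular_operad = fin_operad Smor \<O> for \<O> :: "'u elt operad"
begin

text \<open>The generating relation of the tensor product is already an equivalence relation on the
  pairs that matter, because the identification runs over a group.\<close>

lemma tensor_step_iff: "((f, a), (g, b)) \<in> tensor_step \<O> k n \<longleftrightarrow>
    (\<exists>\<sigma> \<in> Perm k. g \<in> Imor k n \<and> a \<in> Ops \<O> k \<and> f = fcomp g \<sigma> \<and> b = act \<O> k \<sigma> a)"
  unfolding tensor_step_def by blast

lemma sym_tensor_step: "sym (tensor_step \<O> k n)"
proof (rule symI)
  fix x y assume "(x, y) \<in> tensor_step \<O> k n"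
  then obtain g \<sigma> a where *: "x = (fcomp g \<sigma>, a)" "y = (g, act \<O> k \<sigma> a)"
    "g \<in> Imor k n" "\<sigma> \<in> Perm k" "a \<in> Ops \<O> k"
    unfolding tensor_step_def by blast
  obtain \<tau> where \<tau>: "\<tau> \<in> Perm k" "fcomp \<sigma> \<tau> = fid k" "fcomp \<tau> \<sigma> = fid k"
    using Perm_inverse *(4) by blast
  have "fcomp (fcomp g \<sigma>) \<tau> = g"
    using * \<tau> by (subst fcomp_assoc[of _ k k]) (auto intro: Smor_Fmor fcomp_fid dest: Imor_length Smor_length)
  moreover have "act \<O> k \<tau> (act \<O> k \<sigma> a) = a"
    using * \<tau> act_comp[of \<sigma> k k \<tau> k a] act_id by auto
  ultimately show "(y, x) \<in> tensor_step \<O> k n"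
    using * \<tau> act_closed[of \<sigma> k k a] fcomp_Imor[of \<sigma> k k g n] unfolding * tensor_step_iff
    by (intro bexI[of _ \<tau>]) auto
qed

lemma trans_tensor_step: "trans (tensor_step \<O> k n)"
proof (rule transI)
  fix x y z assume "(x, y) \<in> tensor_step \<O> k n" "(y, z) \<in> tensor_step \<O> k n"
  then obtain g \<sigma> a \<tau> where *: "x = (fcomp (fcomp g \<tau>) \<sigma>, a)" "z = (g, act \<O> k \<tau> (act \<O> k \<sigma> a))"
    "g \<in> Imor k n" "\<sigma> \<in> Perm k" "\<tau> \<in> Perm k" "a \<in> Ops \<O> k"
    unfolding tensor_step_def by blast
  have "fcomp (fcomp g \<tau>) \<sigma> = fcomp g (fcomp \<tau> \<sigma>)"
    using * by (intro fcomp_assoc[of _ k k]) (auto intro: Smor_Fmor Smor_length)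
  moreover have "act \<O> k \<tau> (act \<O> k \<sigma> a) = act \<O> k (fcomp \<tau> \<sigma>) a"
    using * act_comp[of \<sigma> k k \<tau> k a] by auto
  ultimately show "(x, z) \<in> tensor_step \<O> k n"
    using * fcomp_Imor[of \<sigma> k k \<tau> k] fcomp_Smor[of \<sigma> k k \<tau> k] unfolding * tensor_step_iff
    by (intro bexI[of _ "fcomp \<tau> \<sigma>"]) auto
qed

lemma tensor_step_refl: "f \<in> Imor k n \<Longrightarrow> a \<in> Ops \<O> k \<Longrightarrow> ((f, a), (f, a)) \<in> tensor_step \<O> k n"
  unfolding tensor_step_iff
  by (intro bexI[of _ "fid k"]) (auto simp: act_id fcomp_fid Imor_length)

text \<open>Symmetry and transitivity reduce the generated equivalence to the reflexive closure of
  one step. The hypotheses matter: the step is reflexive on genuine pairs only, and any other pair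
  has a singleton class but no step.\<close>

lemma tensor_class:
  assumes "f \<in> Imor k n" "a \<in> Ops \<O> k"
  shows "tensor_equiv \<O> k n `` {(f, a)} = tensor_step \<O> k n `` {(f, a)}"
proof -
  have "tensor_equiv \<O> k n = (tensor_step \<O> k n)\<^sup>*"
    using sym_tensor_step[of k n] by (simp add: tensor_equiv_def sym_conv_converse_eq)
  also have "\<dots> = (tensor_step \<O> k n)\<^sup>="
    using trans_tensor_step[of k n] by (metis rtrancl_trancl_reflcl trancl_id)
  finally show ?thesis using tensor_step_refl[OF assms] by auto
qed

text \<open>\<open>Abs_fset\<close> is injective only on finite sets. One direction of the step
  controls the operation in \<open>y\<close>; the first component has the form
  \<open>fcomp f \<tau>\<close> only by the reversed step, hence the appeal to symmetry.\<close>

lemma finite_tensor_class: "finite (tensor_step \<O> k n `` {(f, a)})"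
proof (rule finite_subset)
  show "tensor_step \<O> k n `` {(f, a)} \<subseteq> (\<lambda>(\<tau>, \<sigma>). (fcomp f \<tau>, act \<O> k \<sigma> a)) ` (Perm k \<times> Perm k)"
  proof
    fix y assume "y \<in> tensor_step \<O> k n `` {(f, a)}"
    then have "((f, a), y) \<in> tensor_step \<O> k n" "(y, (f, a)) \<in> tensor_step \<O> k n"
      using sym_tensor_step[of k n] by (auto dest: symD)
    then show "y \<in> (\<lambda>(\<tau>, \<sigma>). (fcomp f \<tau>, act \<O> k \<sigma> a)) ` (Perm k \<times> Perm k)"
      unfolding tensor_step_def by (auto simp: image_iff)
  qed
qed (simp add: finite_Perm)

text \<open>Equal classes come with a single permutation that relates the representatives. The tag
  of \<open>Tensor\<close> separates different summands of the coproduct.\<close>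

lemma tensor_eq_iff:
  assumes "f \<in> Imor k n" "a \<in> Ops \<O> k" "g \<in> Imor l n" "b \<in> Ops \<O> l"
  shows "tensor \<O> k n f a = tensor \<O> l n g b \<longleftrightarrow>
    k = l \<and> (\<exists>\<sigma> \<in> Perm k. f = fcomp g \<sigma> \<and> b = act \<O> k \<sigma> a)"
proof (cases "k = l")
  case True
  have "tensor \<O> k n f a = tensor \<O> l n g b \<longleftrightarrow>
      tensor_step \<O> k n `` {(f, a)} = tensor_step \<O> k n `` {(g, b)}"
    using assms finite_tensor_class unfolding tensor_def
    by (simp add: tensor_class True Abs_fset_inject)
  also have "\<dots> \<longleftrightarrow> ((f, a), (g, b)) \<in> tensor_step \<O> k n"
    using sym_tensor_step[of k n] trans_tensor_step[of k n] tensor_step_refl[OF assms(3,4)] True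
    by (auto dest: symD transD)
  also have "\<dots> \<longleftrightarrow> (\<exists>\<sigma> \<in> Perm k. f = fcomp g \<sigma> \<and> b = act \<O> k \<sigma> a)"
    using assms unfolding tensor_step_iff True by blast
  finally show ?thesis using True by simp
qed (simp add: tensor_def)

text \<open>The bijection may have differently written domain and codomain, because the arities
  produced by \<open>star\<close> are sums over different lists; \<open>bij_mor_eq\<close>
  identifies them.\<close>

lemma tensor_eqI:
  assumes "g \<in> Imor l n" "\<sigma> \<in> Smor k l" "\<sigma> \<in> Imor k l" "a \<in> Ops \<O> k"
  shows "tensor \<O> k n (fcomp g \<sigma>) a = tensor \<O> l n g (act \<O> l \<sigma> a)"
proof -
  have "k = l" using assms bij_mor_eq by blast
  then show ?thesis
    using assms act_closed[of \<sigma> k l a] fcomp_Imor[of \<sigma> k l g n] by (subst tensor_eq_iff) auto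
qed

section \<open>The operations on classes and the laws of a full operad\<close>

abbreviation "P \<equiv> P_ob \<O>"

lemma Ops_P: "Ops P n = {tensor \<O> k n f a | k f a. f \<in> Imor k n \<and> a \<in> Ops \<O> k}"
  by (simp add: P_ob_def)

lemma tensor_in_Ops [intro]: "f \<in> Imor k n \<Longrightarrow> a \<in> Ops \<O> k \<Longrightarrow> tensor \<O> k n f a \<in> Ops P n"
  by (auto simp: Ops_P)

lemma Ops_P_cases:
  assumes "x \<in> Ops P n"
  obtains k f a where "f \<in> Imor k n" "a \<in> Ops \<O> k" "x = tensor \<O> k n f a"
  using assms by (auto simp: Ops_P)

lemma iota_P: "iota P = tensor \<O> 1 1 (fid 1) (iota \<O>)"
  by (simp add: P_ob_def)

text \<open>Another representative differs by some \<open>\<sigma>\<close>; composing its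
  factorization with \<open>\<sigma>\<close> gives a second factorization of
  \<open>fcomp \<phi> f\<close>. Uniqueness supplies a bijection \<open>\<theta>\<close> between the
  two, which functoriality of the action and \<open>tensor_eqI\<close> absorb.\<close>

lemma act_P:
  assumes "f \<in> Imor k n" "a \<in> Ops \<O> k" "length \<phi> = n"
    and "p \<in> Smor k l" "g \<in> Imor l m" "fcomp \<phi> f = fcomp g p"
  shows "act P m \<phi> (tensor \<O> k n f a) = tensor \<O> l m g (act \<O> l p a)"
proof -
  have "tensor \<O> l' m g' (act \<O> l' p' a') = tensor \<O> l m g (act \<O> l p a)"
    if f': "f' \<in> Imor k' n" "a' \<in> Ops \<O> k'" "tensor \<O> k n f a = tensor \<O> k' n f' a'"
      "p' \<in> Smor k' l'" "g' \<in> Imor l' m" "fcomp \<phi> f' = fcomp g' p'" for k' f' a' l' g' p'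
  proof -
    obtain \<sigma> where \<sigma>: "k' = k" "\<sigma> \<in> Perm k" "f = fcomp f' \<sigma>" "a' = act \<O> k \<sigma> a"
      using f'(3) unfolding tensor_eq_iff[OF assms(1,2) f'(1,2)] by blast
    have "fcomp g p = fcomp (fcomp \<phi> f') \<sigma>"
      using \<sigma> f' assms fcomp_assoc[OF Imor_Fmor, of \<sigma> k k f' \<phi>] Imor_length[OF f'(1)] by auto
    also have "\<dots> = fcomp g' (fcomp p' \<sigma>)"
      using \<sigma> f' fcomp_assoc[of \<sigma> k k p' g'] by (auto dest: Smor_length Imor_Fmor)
    finally have e: "fcomp g p = fcomp g' (fcomp p' \<sigma>)" .
    have "fcomp p' \<sigma> \<in> Smor k l'" using \<sigma> f' fcomp_Smor by auto
    then obtain \<theta> where \<theta>: "\<theta> \<in> Smor l l'" "\<theta> \<in> Imor l l'" "g = fcomp g' \<theta>" "fcomp p' \<sigma> = fcomp \<theta> p"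
      using image_factorization_unique[OF assms(4,5) _ f'(5) e] by blast
    have "act \<O> l' p' a' = act \<O> l' (fcomp p' \<sigma>) a"
      using \<sigma> f' assms act_comp[of \<sigma> k k p' l' a] by auto
    also have "\<dots> = act \<O> l' \<theta> (act \<O> l p a)"
      using \<theta> assms act_comp[of p k l \<theta> l' a] by auto
    finally show ?thesis
      using \<theta> assms f' act_closed[of p k l a] by (simp add: tensor_eqI)
  qed
  note * = this
  show ?thesis
    unfolding P_ob_def operad.simps assms(3)
  proof (rule the_equality, goal_cases)
    case 1
    show ?case using assms by blast
  next
    case (2 y)
    then show ?case using * by blast
  qed
qed

text \<open>Other representatives differ by \<open>\<sigma>\<close> outside and by
  \<open>\<tau> i\<close> inside. These combine into one permutation \<open>?\<rho>\<close>: the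
  interchange law extracts it from the injections and \<open>mul_act\<close> from the operations, so
  \<open>tensor_eqI\<close> applies.\<close>

lemma mul_P:
  assumes "f \<in> Imor k (length ns)" "a \<in> Ops \<O> k" "length ys = length ns"
    and "\<And>i. i < length ns \<Longrightarrow> fs i \<in> Imor (ks i) (ns ! i)"
    and "\<And>i. i < length ns \<Longrightarrow> bs i \<in> Ops \<O> (ks i)"
    and "\<And>i. i < length ns \<Longrightarrow> ys ! i = tensor \<O> (ks i) (ns ! i) (fs i) (bs i)"
  shows "mul P ns ys (tensor \<O> k (length ns) f a) =
    tensor \<O> (sum_list (map ks f)) (sum_list ns) (star ns (map fs [0..<length ns]) f)
      (mul \<O> (map ks f) (map bs f) a)"
proof -
  let ?N = "length ns"
  have fl: "length f = k" "set f \<subseteq> {..<?N}" using assms(1) by (auto simp: Imor_def Fmor_def)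
  have "tensor \<O> (sum_list (map ((!) ks') f')) (sum_list ns) (star ns fs' f')
        (mul \<O> (map ((!) ks') f') (map ((!) bs') f') a') =
      tensor \<O> (sum_list (map ks f)) (sum_list ns) (star ns (map fs [0..<length ns]) f)
        (mul \<O> (map ks f) (map bs f) a)"
    if f': "f' \<in> Imor k' ?N" and a': "a' \<in> Ops \<O> k'"
      and eq: "tensor \<O> k ?N f a = tensor \<O> k' ?N f' a'"
      and l: "length ks' = ?N" "length fs' = ?N" "length bs' = ?N"
      and ys: "\<forall>i < ?N. fs' ! i \<in> Imor (ks' ! i) (ns ! i) \<and> bs' ! i \<in> Ops \<O> (ks' ! i) \<and>
        ys ! i = tensor \<O> (ks' ! i) (ns ! i) (fs' ! i) (bs' ! i)"
    for k' f' a' ks' fs' bs'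
  proof -
    obtain \<sigma> where \<sigma>: "k' = k" "\<sigma> \<in> Perm k" "f = fcomp f' \<sigma>" "a' = act \<O> k \<sigma> a"
      using eq unfolding tensor_eq_iff[OF assms(1,2) f' a'] by blast
    have "\<exists>\<tau>. ks' ! i = ks i \<and> \<tau> \<in> Perm (ks i) \<and> fs i = fcomp (fs' ! i) \<tau> \<and>
        bs' ! i = act \<O> (ks i) \<tau> (bs i)" if "i < ?N" for i
      using ys assms(4,5,6) that tensor_eq_iff[of "fs i" "ks i" "ns ! i" "bs i" "fs' ! i" "ks' ! i" "bs' ! i"]
      by auto
    then obtain \<tau> where \<tau>: "\<And>i. i < ?N \<Longrightarrow> ks' ! i = ks i" "\<And>i. i < ?N \<Longrightarrow> \<tau> i \<in> Perm (ks i)"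
      "\<And>i. i < ?N \<Longrightarrow> fs i = fcomp (fs' ! i) (\<tau> i)" "\<And>i. i < ?N \<Longrightarrow> bs' ! i = act \<O> (ks i) (\<tau> i) (bs i)"
      by metis
    have f'l: "length f' = k" "set f' \<subseteq> {..<?N}" using f' \<sigma>(1) by (auto simp: Imor_def Fmor_def)
    have m: "map ((!) ks') f' = map ks f'" "map ((!) bs') f' = map (\<lambda>i. act \<O> (ks i) (\<tau> i) (bs i)) f'"
      using \<tau> f'l by auto
    \<comment> \<open>Permutes whole blocks by \<open>\<sigma>\<close> and the entries of each block
      by the \<open>\<tau> i\<close> that belongs to it.\<close>
    let ?\<rho> = "star (map ks f') (map \<tau> f') \<sigma>"
    have \<sigma>': "\<sigma> \<in> Smor k (length (map ks f'))" "\<sigma> \<in> Imor k (length (map ks f'))"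
      using \<sigma> f'l by auto
    have \<tau>': "map \<tau> f' ! i \<in> Perm (ks (f' ! i))" "map ks f' ! i = ks (f' ! i)"
      if "i < length (map ks f')" for i
    proof -
      have "f' ! i < ?N" using subsetD[OF f'l(2), of "f' ! i"] that by auto
      then show "map \<tau> f' ! i \<in> Perm (ks (f' ! i))" "map ks f' ! i = ks (f' ! i)"
        using \<tau>(2) that by auto
    qed
    have kf: "map ks f = map (\<lambda>i. ks (f' ! i)) \<sigma>" by (simp add: \<sigma>(3) map_nth_fcomp)
    have \<rho>: "?\<rho> \<in> Smor (sum_list (map ks f)) (sum_list (map ks f'))"
      "?\<rho> \<in> Imor (sum_list (map ks f)) (sum_list (map ks f'))"
      using star_Smor[OF \<sigma>'(1), of "map \<tau> f'" "\<lambda>i. ks (f' ! i)"]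
        star_Imor[OF \<sigma>'(2), of "map \<tau> f'" "\<lambda>i. ks (f' ! i)"] \<tau>' unfolding kf by auto
    have "star ns (map fs [0..<?N]) f = star ns (map (\<lambda>i. fcomp (fs' ! i) (\<tau> i)) [0..<?N]) (fcomp f' \<sigma>)"
      using \<tau>(3) \<sigma>(3) by (auto intro: arg_cong3[where f = star])
    also have "\<dots> = fcomp (star ns fs' f') ?\<rho>"
      using \<sigma> f' \<tau>(1,2) ys by (intro fcomp_star[symmetric, of _ k]) (auto dest: Imor_Fmor Imor_length)
    finally have 1: "star ns (map fs [0..<?N]) f = fcomp (star ns fs' f') ?\<rho>" .
    have 2: "mul \<O> (map ks f') (map (\<lambda>i. act \<O> (ks i) (\<tau> i) (bs i)) f') a' =
        act \<O> (sum_list (map ks f')) ?\<rho> (mul \<O> (map ks f) (map bs f) a)"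
      unfolding \<sigma>(3,4) using \<sigma> \<tau> f'l assms by (intro mul_act_map) auto
    have 3: "star ns fs' f' \<in> Imor (sum_list (map ks f')) (sum_list ns)"
      using f' ys \<tau>(1) by (intro star_Imor) auto
    have 4: "mul \<O> (map ks f) (map bs f) a \<in> Ops \<O> (sum_list (map ks f))"
      using assms fl by (intro mul_closed_map) auto
    show ?thesis unfolding m 1 2 tensor_eqI[OF 3 \<rho> 4] ..
  qed
  note * = this
  \<comment> \<open>The definition of \<open>mul\<close> quantifies over lists, so the given
    families enter it tabulated over \<open>[0..<?N]\<close>.\<close>
  have m: "map ((!) (map ks [0..<?N])) f = map ks f" "map ((!) (map bs [0..<?N])) f = map bs f"
    using fl by auto
  show ?thesis
    unfolding P_ob_def operad.simps
  proof (rule the_equality, goal_cases)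
    case 1
    show ?case
      using assms
      by - (rule exI[of _ k], rule exI[of _ f], rule exI[of _ a], rule exI[of _ "map ks [0..<?N]"],
        rule exI[of _ "map fs [0..<?N]"], rule exI[of _ "map bs [0..<?N]"], auto simp: m)
  next
    case (2 y)
    then show ?case using * by blast
  qed
qed

text \<open>A fixed choice of representatives: \<open>mul_P\<close> needs them for a whole family of
  classes at once, and \<open>unpack\<close> needs one term for each class.\<close>

definition rep :: "nat \<Rightarrow> 'u elt \<Rightarrow> nat \<times> nat list \<times> 'u elt"
  where "rep n x = (SOME (k, f, a). f \<in> Imor k n \<and> a \<in> Ops \<O> k \<and> x = tensor \<O> k n f a)"

abbreviation "rep_arity n x \<equiv> fst (rep n x)"
abbreviation "rep_inj n x \<equiv> fst (snd (rep n x))"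
abbreviation "rep_op n x \<equiv> snd (snd (rep n x))"

lemma rep:
  assumes "x \<in> Ops P n"
  shows "rep_inj n x \<in> Imor (rep_arity n x) n" "rep_op n x \<in> Ops \<O> (rep_arity n x)"
    "x = tensor \<O> (rep_arity n x) n (rep_inj n x) (rep_op n x)"
proof -
  have "case rep n x of (k, f, a) \<Rightarrow> f \<in> Imor k n \<and> a \<in> Ops \<O> k \<and> x = tensor \<O> k n f a"
    unfolding rep_def using assms[unfolded Ops_P]
    by (intro someI_ex[of "\<lambda>(k, f, a). f \<in> Imor k n \<and> a \<in> Ops \<O> k \<and> x = tensor \<O> k n f a"]) auto
  then show "rep_inj n x \<in> Imor (rep_arity n x) n" "rep_op n x \<in> Ops \<O> (rep_arity n x)"
    "x = tensor \<O> (rep_arity n x) n (rep_inj n x) (rep_op n x)"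
    by (auto split: prod.splits)
qed

lemma mul_P_closed_map:
  assumes "f \<in> Imor k N" "a \<in> Ops \<O> k" "\<And>i. i < N \<Longrightarrow> bs i \<in> Ops \<O> (ks i)"
  shows "mul \<O> (map ks f) (map bs f) a \<in> Ops \<O> (sum_list (map ks f))"
  using assms by (intro mul_closed_map) (auto simp: Imor_def Fmor_def)

lemma mul_P_closed:
  assumes "has_arities P ns ys" "x \<in> Ops P (length ns)"
  shows "mul P ns ys x \<in> Ops P (sum_list ns)"
proof -
  have l: "length ys = length ns" using has_arities_length[OF assms(1)] .
  have y: "ys ! i \<in> Ops P (ns ! i)" if "i < length ns" for i
    using assms(1) that by (simp add: list_all2_conv_all_nth)
  obtain k f a where x: "f \<in> Imor k (length ns)" "a \<in> Ops \<O> k" "x = tensor \<O> k (length ns) f a"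
    using Ops_P_cases[OF assms(2)] .
  note r = rep[OF y]
  have "mul P ns ys x = tensor \<O> (sum_list (map (\<lambda>i. rep_arity (ns ! i) (ys ! i)) f)) (sum_list ns)
      (star ns (map (\<lambda>i. rep_inj (ns ! i) (ys ! i)) [0..<length ns]) f)
      (mul \<O> (map (\<lambda>i. rep_arity (ns ! i) (ys ! i)) f) (map (\<lambda>i. rep_op (ns ! i) (ys ! i)) f) a)"
    unfolding x(3) using r by (intro mul_P[OF x(1,2) l])
  moreover have "star ns (map (\<lambda>i. rep_inj (ns ! i) (ys ! i)) [0..<length ns]) f
      \<in> Imor (sum_list (map (\<lambda>i. rep_arity (ns ! i) (ys ! i)) f)) (sum_list ns)"
    using r(1) by (intro star_Imor[OF x(1)]) auto
  ultimately show ?thesis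
    using r(2) mul_P_closed_map[OF x(1,2)] by (metis (no_types, lifting) tensor_in_Ops)
qed

lemma act_P_cases:
  assumes "f \<in> Imor k n" "a \<in> Ops \<O> k" "\<phi> \<in> Fmor n m"
  obtains l g p where "p \<in> Smor k l" "g \<in> Imor l m" "fcomp \<phi> f = fcomp g p"
    "act P m \<phi> (tensor \<O> k n f a) = tensor \<O> l m g (act \<O> l p a)"
proof -
  have "fcomp \<phi> f \<in> Fmor k m" using assms fcomp_Fmor Imor_Fmor by blast
  then obtain p l g where *: "p \<in> Smor k l" "g \<in> Imor l m" "fcomp \<phi> f = fcomp g p"
    using image_factorization by blast
  then show ?thesis using act_P[OF assms(1,2) Fmor_length[OF assms(3)] *] that by blast
qed

text \<open>With representatives at all three levels, \<open>mul_P\<close> evaluates both sides. The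
  injections then agree by \<open>star_star\<close> and the operations by associativity in the given
  operad.\<close>

lemma mul_P_assoc:
  assumes css: "list_all2 (has_arities P) mss css"
    and bs: "list_all2 (\<lambda>ms b. b \<in> Ops P (length ms)) mss bs" and x: "x \<in> Ops P (length mss)"
  shows "mul P (map sum_list mss) (map (\<lambda>i. mul P (mss ! i) (css ! i) (bs ! i)) [0..<length mss]) x =
    mul P (concat mss) (concat css) (mul P (map length mss) bs x)"
proof -
  let ?N = "length mss"
  have lb: "length bs = ?N" and lc: "length css = ?N" using bs css by (auto dest: list_all2_lengthD)
  have b: "bs ! i \<in> Ops P (length (mss ! i))" if "i < ?N" for i
    using bs that by (simp add: list_all2_conv_all_nth)
  have c: "css ! i ! r \<in> Ops P (mss ! i ! r)" "length (css ! i) = length (mss ! i)"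
    if "i < ?N" "r < length (mss ! i)" for i r
    using css that by (auto simp: list_all2_conv_all_nth)
  have lci: "length (css ! i) = length (mss ! i)" if "i < ?N" for i
    using css that by (auto simp: list_all2_conv_all_nth)
  obtain k f a where x: "f \<in> Imor k ?N" "a \<in> Ops \<O> k" "x = tensor \<O> k ?N f a"
    using Ops_P_cases[OF x] .
  have fl: "length f = k" "set f \<subseteq> {..<?N}" using x(1) by (auto simp: Imor_def Fmor_def)
  define kb where "kb i = rep_arity (length (mss ! i)) (bs ! i)" for i
  define g where "g i = rep_inj (length (mss ! i)) (bs ! i)" for i
  define b where "b i = rep_op (length (mss ! i)) (bs ! i)" for i
  define kc where "kc i r = rep_arity (mss ! i ! r) (css ! i ! r)" for i r
  define h where "h i r = rep_inj (mss ! i ! r) (css ! i ! r)" for i r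
  define c where "c i r = rep_op (mss ! i ! r) (css ! i ! r)" for i r
  have B: "g i \<in> Imor (kb i) (length (mss ! i))" "b i \<in> Ops \<O> (kb i)"
    "bs ! i = tensor \<O> (kb i) (length (mss ! i)) (g i) (b i)" if "i < ?N" for i
    unfolding kb_def g_def b_def using rep[OF \<open>\<And>i. i < ?N \<Longrightarrow> bs ! i \<in> Ops P (length (mss ! i))\<close>[OF that]] .
  have C: "h i r \<in> Imor (kc i r) (mss ! i ! r)" "c i r \<in> Ops \<O> (kc i r)"
    "css ! i ! r = tensor \<O> (kc i r) (mss ! i ! r) (h i r) (c i r)"
    if "i < ?N" "r < length (mss ! i)" for i r
    unfolding kc_def h_def c_def
    using rep[OF \<open>\<And>i r. i < ?N \<Longrightarrow> r < length (mss ! i) \<Longrightarrow> css ! i ! r \<in> Ops P (mss ! i ! r)\<close>[OF that]] .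
  have gl: "length (g i) = kb i" "set (g i) \<subseteq> {..<length (mss ! i)}" if "i < ?N" for i
    using B(1)[OF that] by (auto simp: Imor_def Fmor_def)

  \<comment> \<open>\<open>st i\<close> and \<open>mu i\<close> are the injection and the operation
    of the \<open>i\<close>-th inner product on the left side.\<close>
  define st where "st i = star (mss ! i) (map (h i) [0..<length (mss ! i)]) (g i)" for i
  define mu where "mu i = mul \<O> (map (kc i) (g i)) (map (c i) (g i)) (b i)" for i
  have inner: "mul P (mss ! i) (css ! i) (bs ! i) =
      tensor \<O> (sum_list (map (kc i) (g i))) (sum_list (mss ! i)) (st i) (mu i)" if "i < ?N" for i
    unfolding B(3)[OF that] st_def mu_def
    using B C lci that by (intro mul_P) auto
  have st: "st i \<in> Imor (sum_list (map (kc i) (g i))) (sum_list (mss ! i))" if "i < ?N" for i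
    unfolding st_def using B C that by (intro star_Imor) auto
  have mu: "mu i \<in> Ops \<O> (sum_list (map (kc i) (g i)))" if "i < ?N" for i
    unfolding mu_def using C that by (intro mul_P_closed_map[OF B(1,2)[OF that]]) auto
  have L: "mul P (map sum_list mss) (map (\<lambda>i. mul P (mss ! i) (css ! i) (bs ! i)) [0..<?N]) x =
    tensor \<O> (sum_list (map (\<lambda>i. sum_list (map (kc i) (g i))) f)) (sum_list (map sum_list mss))
      (star (map sum_list mss) (map st [0..<?N]) f)
      (mul \<O> (map (\<lambda>i. sum_list (map (kc i) (g i))) f) (map mu f) a)"
    using mul_P[of f k "map sum_list mss" a "map (\<lambda>i. mul P (mss ! i) (css ! i) (bs ! i)) [0..<?N]" st
      "\<lambda>i. sum_list (map (kc i) (g i))" mu] x inner st mu by simp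

  \<comment> \<open>\<open>S\<close> and \<open>bb\<close> are the injection and the operation of
    the product that the right side forms first.\<close>
  define S where "S = star (map length mss) (map g [0..<?N]) f"
  define bb where "bb = mul \<O> (map kb f) (map b f) a"
  have R1: "mul P (map length mss) bs x =
    tensor \<O> (sum_list (map kb f)) (length (concat mss)) S bb"
    unfolding x(3) S_def bb_def
    using mul_P[of f k "map length mss" a bs g kb b] x B lb by (simp add: length_concat)
  have S: "S \<in> Imor (sum_list (map kb f)) (length (concat mss))"
    unfolding S_def using star_Imor[of f k "map length mss" "map g [0..<?N]" kb] x B by (simp add: length_concat)
  have bb: "bb \<in> Ops \<O> (sum_list (map kb f))"
    unfolding bb_def using B by (intro mul_P_closed_map[OF x(1,2)]) auto
  let ?ls = "map length mss"
  let ?hss = "map (\<lambda>i. map (h i) [0..<?ls ! i]) [0..<length ?ls]"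
  \<comment> \<open>Every flat index comes from a pair \<open>(p, r)\<close>, at which all the
    flattened lists and tables take their two-index values; this transfers \<open>C\<close> to the
    premises of \<open>mul_P\<close>.\<close>
  have flat: "\<exists>p r. p < ?N \<and> r < length (mss ! p) \<and> concat mss ! i = mss ! p ! r \<and>
      concat css ! i = css ! p ! r \<and> table ?ls kc ! i = kc p r \<and> table ?ls h ! i = h p r \<and>
      table ?ls c ! i = c p r" if i: "i < length (concat mss)" for i
  proof -
    have "i < sum_list ?ls" using i by (simp add: length_concat)
    then obtain p r where pr: "p < length ?ls" "r < ?ls ! p" "i = sum_list (take p ?ls) + r"
      by (rule offset_cases)
    have "map length css = ?ls" using lci lc by (intro nth_equalityI) auto
    then have "concat css ! i = css ! p ! r"
      using pr lc lci nth_concat_offset(2)[of p css r] by simp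
    moreover have "concat mss ! i = mss ! p ! r"
      using pr nth_concat_offset(2)[of p mss r] by simp
    moreover have "p < ?N" "r < length (mss ! p)" using pr by auto
    ultimately show ?thesis
      unfolding pr(3) nth_table[OF pr(1,2)] by blast
  qed
  have lcc: "length (concat css) = length (concat mss)"
    using lc lci by (simp add: length_concat) (metis (no_types, lifting) map_equality_iff)
  \<comment> \<open>Stated at two types because the type of \<open>F\<close> is fixed within a
    proof: \<open>kc\<close> takes arities as values and \<open>c\<close> operations.\<close>
  have tab: "map ((!) (table ?ls F)) S = concat (map (\<lambda>i. map (F i) (g i)) f)" for F :: "nat \<Rightarrow> nat \<Rightarrow> nat"
    using map_table_star[of f ?ls g F] fl gl unfolding S_def by simp
  have tab': "map ((!) (table ?ls F)) S = concat (map (\<lambda>i. map (F i) (g i)) f)" for F :: "nat \<Rightarrow> nat \<Rightarrow> 'u elt"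
    using map_table_star[of f ?ls g F] fl gl unfolding S_def by simp
  have R2: "mul P (concat mss) (concat css) (tensor \<O> (sum_list (map kb f)) (length (concat mss)) S bb) =
    tensor \<O> (sum_list (map ((!) (table ?ls kc)) S)) (sum_list (concat mss))
      (star (concat mss) (map ((!) (table ?ls h)) [0..<length (concat mss)]) S)
      (mul \<O> (map ((!) (table ?ls kc)) S) (map ((!) (table ?ls c)) S) bb)"
  proof (rule mul_P[OF S bb lcc])
    fix i assume "i < length (concat mss)"
    from flat[OF this] C show "table ?ls h ! i \<in> Imor (table ?ls kc ! i) (concat mss ! i)"
      "table ?ls c ! i \<in> Ops \<O> (table ?ls kc ! i)"
      "concat css ! i = tensor \<O> (table ?ls kc ! i) (concat mss ! i) (table ?ls h ! i) (table ?ls c ! i)"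
      by auto
  qed
  have 1: "star (concat mss) (map ((!) (table ?ls h)) [0..<length (concat mss)]) S =
      star (map sum_list mss) (map st [0..<?N]) f"
  proof -
    have "map ((!) (table ?ls h)) [0..<length (concat mss)] = concat ?hss"
      using map_nth[of "table ?ls h"] length_table[of h ?ls] by (simp add: length_concat)
    moreover have "star (concat mss) (concat ?hss) (star ?ls (map g [0..<?N]) f) =
      star (map sum_list mss) (map (\<lambda>i. star (mss ! i) (?hss ! i) (map g [0..<?N] ! i)) [0..<?N]) f"
      using x(1) B(1) by (intro star_star[of f k mss _ kb]) (auto intro: Imor_Fmor nth_equalityI)
    moreover have "map (\<lambda>i. star (mss ! i) (?hss ! i) (map g [0..<?N] ! i)) [0..<?N] = map st [0..<?N]"
      by (auto simp: st_def)
    ultimately show ?thesis unfolding S_def by (simp only: length_map)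
  qed
  have 2: "mul \<O> (map (\<lambda>i. sum_list (map (kc i) (g i))) f) (map mu f) a =
      mul \<O> (concat (map (\<lambda>i. map (kc i) (g i)) f)) (concat (map (\<lambda>i. map (c i) (g i)) f)) bb"
  proof -
    have "map (\<lambda>i. length (map (kc i) (g i))) f = map kb f"
      using fl gl by auto
    moreover have "mul \<O> (map (\<lambda>i. sum_list (map (kc i) (g i))) f) (map mu f) a =
      mul \<O> (concat (map (\<lambda>i. map (kc i) (g i)) f)) (concat (map (\<lambda>i. map (c i) (g i)) f))
        (mul \<O> (map (\<lambda>i. length (map (kc i) (g i))) f) (map b f) a)"
      unfolding mu_def using x(2) fl gl B(2) C(2)
      by (intro mul_assoc_map) (auto simp: list_all2_conv_all_nth subset_iff)
    ultimately show ?thesis unfolding bb_def by (simp only:)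
  qed
  have 3: "sum_list (concat (map (\<lambda>i. map (kc i) (g i)) f)) = sum_list (map (\<lambda>i. sum_list (map (kc i) (g i))) f)"
    "sum_list (concat mss) = sum_list (map sum_list mss)"
    by (simp_all add: sum_list_concat_map comp_def)
  show ?thesis unfolding L R1 R2 1 2 tab tab' 3 ..
qed

text \<open>Factor \<open>\<phi>\<close> after \<open>f\<close> as \<open>f'\<close> after
  \<open>p\<close>, and each \<open>\<psi>s ! i\<close> after \<open>g i\<close> as
  \<open>g' i\<close> after \<open>q i\<close>. The \<open>star\<close> of the injections and the
  \<open>star\<close> of the surjections then factor the function on the right side, and
  \<open>act_P\<close> accepts this factorization. On operations, what remains is
  \<open>mul_act\<close> for surjections.\<close>

lemma mul_P_act:
  assumes \<phi>: "\<phi> \<in> Fmor n m" and x: "x \<in> Ops P n"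
    and l: "length ks = m" "length ls = m" "length \<psi>s = m" "length bs = m"
    and \<psi>: "\<And>i. i < m \<Longrightarrow> \<psi>s ! i \<in> Fmor (ks ! i) (ls ! i)"
    and bs: "\<And>i. i < m \<Longrightarrow> bs ! i \<in> Ops P (ks ! i)"
  shows "mul P ls (map (\<lambda>i. act P (ls ! i) (\<psi>s ! i) (bs ! i)) [0..<m]) (act P m \<phi> x) =
    act P (sum_list ls) (star ls \<psi>s \<phi>) (mul P (map (\<lambda>i. ks ! i) \<phi>) (map (\<lambda>i. bs ! i) \<phi>) x)"
proof -
  obtain k f a where x: "f \<in> Imor k n" "a \<in> Ops \<O> k" "x = tensor \<O> k n f a"
    using Ops_P_cases[OF x] .
  obtain l f' p where p: "p \<in> Smor k l" "f' \<in> Imor l m" "fcomp \<phi> f = fcomp f' p"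
    "act P m \<phi> x = tensor \<O> l m f' (act \<O> l p a)"
    using act_P_cases[OF x(1,2) \<phi>] x(3) by metis
  define ar where "ar i = rep_arity (ks ! i) (bs ! i)" for i
  define g where "g i = rep_inj (ks ! i) (bs ! i)" for i
  define b where "b i = rep_op (ks ! i) (bs ! i)" for i
  have B: "g i \<in> Imor (ar i) (ks ! i)" "b i \<in> Ops \<O> (ar i)"
    "bs ! i = tensor \<O> (ar i) (ks ! i) (g i) (b i)" if "i < m" for i
    unfolding ar_def g_def b_def using rep[OF bs[OF that]] .
  have "\<exists>r q g'. q \<in> Smor (ar i) r \<and> g' \<in> Imor r (ls ! i) \<and> fcomp (\<psi>s ! i) (g i) = fcomp g' q \<and>
      act P (ls ! i) (\<psi>s ! i) (bs ! i) = tensor \<O> r (ls ! i) g' (act \<O> r q (b i))" if "i < m" for i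
    using act_P_cases[OF B(1,2)[OF that] \<psi>[OF that]] B(3)[OF that] by metis
  then obtain r q g' where Q: "\<And>i. i < m \<Longrightarrow> q i \<in> Smor (ar i) (r i)"
    "\<And>i. i < m \<Longrightarrow> g' i \<in> Imor (r i) (ls ! i)"
    "\<And>i. i < m \<Longrightarrow> fcomp (\<psi>s ! i) (g i) = fcomp (g' i) (q i)"
    "\<And>i. i < m \<Longrightarrow> act P (ls ! i) (\<psi>s ! i) (bs ! i) = tensor \<O> (r i) (ls ! i) (g' i) (act \<O> (r i) (q i) (b i))"
    by metis
  have fl: "length f' = l" "\<And>i. i \<in> set f' \<Longrightarrow> i < m" "length f = k" "\<And>j. j \<in> set f \<Longrightarrow> j < n"
    using p(2) x(1) by (auto simp: Imor_def Fmor_def)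
  have \<phi>l: "length \<phi> = n" "\<And>j. j < n \<Longrightarrow> \<phi> ! j < m" "\<And>i. i \<in> set \<phi> \<Longrightarrow> i < m"
    using \<phi> by (auto simp: Fmor_def subset_iff)
  let ?p = "star (map r f') (map q f') p" and ?f = "star ls (map g' [0..<m]) f'"
  let ?c = "mul \<O> (map ar (fcomp \<phi> f)) (map b (fcomp \<phi> f)) a"
  have "mul P ls (map (\<lambda>i. act P (ls ! i) (\<psi>s ! i) (bs ! i)) [0..<m]) (act P m \<phi> x) =
    tensor \<O> (sum_list (map r f')) (sum_list ls) ?f
      (mul \<O> (map r f') (map (\<lambda>i. act \<O> (r i) (q i) (b i)) f') (act \<O> l p a))"
  proof -
    have "mul P ls (map (\<lambda>i. act P (ls ! i) (\<psi>s ! i) (bs ! i)) [0..<m]) (tensor \<O> l (length ls) f' (act \<O> l p a)) =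
      tensor \<O> (sum_list (map r f')) (sum_list ls) (star ls (map g' [0..<length ls]) f')
      (mul \<O> (map r f') (map (\<lambda>i. act \<O> (r i) (q i) (b i)) f') (act \<O> l p a))"
      using Q p l act_closed[OF p(1) x(2)] act_closed[OF Q(1) B(2)] by (intro mul_P) auto
    then show ?thesis by (simp only: p(4) l(2))
  qed
  also have "mul \<O> (map r f') (map (\<lambda>i. act \<O> (r i) (q i) (b i)) f') (act \<O> l p a) =
      act \<O> (sum_list (map r f')) ?p ?c"
    unfolding p(3) using p(1) x(2) fl Q(1) B(2) by (intro mul_act_map) auto
  also have "tensor \<O> (sum_list (map r f')) (sum_list ls) ?f (act \<O> (sum_list (map r f')) ?p ?c) =
    act P (sum_list ls) (star ls \<psi>s \<phi>)
      (tensor \<O> (sum_list (map ar (fcomp \<phi> f))) (sum_list (map ((!) ks) \<phi>)) (star (map ((!) ks) \<phi>) (map g \<phi>) f) ?c)"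
  proof (rule act_P[symmetric])
    have "star (map ((!) ks) \<phi>) (map g \<phi>) f \<in> Imor (sum_list (map (\<lambda>j. ar (\<phi> ! j)) f)) (sum_list (map ((!) ks) \<phi>))"
      using x(1) \<phi>l B(1) by (intro star_Imor) auto
    then show "star (map ((!) ks) \<phi>) (map g \<phi>) f \<in> Imor (sum_list (map ar (fcomp \<phi> f))) (sum_list (map ((!) ks) \<phi>))"
      by (simp add: map_nth_fcomp)
    show "?c \<in> Ops \<O> (sum_list (map ar (fcomp \<phi> f)))"
      using fl \<phi>l B(2) x(2) by (intro mul_closed_map) (auto simp: fcomp_def)
    have "map (\<lambda>i. length (\<psi>s ! i)) \<phi> = map ((!) ks) \<phi>"
      using \<psi> \<phi>l(3) by (auto dest: Fmor_length)
    then show "length (star ls \<psi>s \<phi>) = sum_list (map ((!) ks) \<phi>)" by (simp only: length_star)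
    have "?p \<in> Smor (sum_list (map (\<lambda>j. ar (f' ! j)) p)) (sum_list (map r f'))"
      using p(1) fl Q(1) by (intro star_Smor) auto
    then show "?p \<in> Smor (sum_list (map ar (fcomp \<phi> f))) (sum_list (map r f'))"
      by (simp add: p(3) map_nth_fcomp)
    show "?f \<in> Imor (sum_list (map r f')) (sum_list ls)"
      using p(2) l Q(2) by (intro star_Imor) auto
    \<comment> \<open>The interchange law collects everything under one \<open>star\<close> over
      \<open>fcomp \<phi> f\<close>, where the given factorizations can be substituted; it is then
      read backwards.\<close>
    have "fcomp (star ls \<psi>s \<phi>) (star (map ((!) ks) \<phi>) (map g \<phi>) f) =
        star ls (map (\<lambda>i. fcomp (\<psi>s ! i) (g i)) [0..<m]) (fcomp \<phi> f)"
      using \<phi> x(1) \<psi> B(1) by (intro fcomp_star[of _ n _ _ k _ _ _ ar]) (auto dest: Fmor_length Imor_Fmor)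
    also have "\<dots> = star ls (map (\<lambda>i. fcomp (map g' [0..<m] ! i) (q i)) [0..<m]) (fcomp f' p)"
      using Q(3) p(3) by (auto intro!: arg_cong3[where f = star])
    also have "\<dots> = fcomp ?f ?p"
      using p Q by (intro fcomp_star[symmetric, of _ l _ _ k _ _ _ ar])
        (auto dest: Smor_Fmor Imor_Fmor Imor_length)
    finally show "fcomp (star ls \<psi>s \<phi>) (star (map ((!) ks) \<phi>) (map g \<phi>) f) = fcomp ?f ?p" .
  qed
  also have "tensor \<O> (sum_list (map ar (fcomp \<phi> f))) (sum_list (map ((!) ks) \<phi>)) (star (map ((!) ks) \<phi>) (map g \<phi>) f) ?c =
      mul P (map ((!) ks) \<phi>) (map ((!) bs) \<phi>) x"
  proof -
    have "mul P (map ((!) ks) \<phi>) (map ((!) bs) \<phi>) (tensor \<O> k (length (map ((!) ks) \<phi>)) f a) =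
      tensor \<O> (sum_list (map (\<lambda>j. ar (\<phi> ! j)) f)) (sum_list (map ((!) ks) \<phi>))
        (star (map ((!) ks) \<phi>) (map (\<lambda>j. g (\<phi> ! j)) [0..<length (map ((!) ks) \<phi>)]) f)
        (mul \<O> (map (\<lambda>j. ar (\<phi> ! j)) f) (map (\<lambda>j. b (\<phi> ! j)) f) a)"
      using x \<phi>l B by (intro mul_P) auto
    moreover have "map (\<lambda>j. g (\<phi> ! j)) [0..<length (map ((!) ks) \<phi>)] = map g \<phi>"
      by (intro nth_equalityI) auto
    ultimately show ?thesis by (simp only: x(3) \<phi>l(1) length_map map_nth_fcomp)
  qed
  finally show ?thesis .
qed

lemma operad_P: "operad Fmor P"
proof
  show "iota P \<in> Ops P 1"
    unfolding iota_P using iota_closed by (intro tensor_in_Ops) auto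
  show "mul P ns bs a \<in> Ops P (sum_list ns)" if "has_arities P ns bs" "a \<in> Ops P (length ns)" for ns bs a
    using mul_P_closed that .
  show "act P m \<phi> x \<in> Ops P m" if \<phi>: "\<phi> \<in> Fmor n m" and x: "x \<in> Ops P n" for \<phi> n m x
  proof -
    obtain k f a where x: "f \<in> Imor k n" "a \<in> Ops \<O> k" "x = tensor \<O> k n f a"
      using Ops_P_cases[OF x] .
    show ?thesis
      by (rule act_P_cases[OF x(1,2) \<phi>]) (use act_closed x in \<open>auto intro!: tensor_in_Ops\<close>)
  qed
  show "act P n (fid n) x = x" if x: "x \<in> Ops P n" for x n
  proof -
    obtain k f a where x: "f \<in> Imor k n" "a \<in> Ops \<O> k" "x = tensor \<O> k n f a"
      using Ops_P_cases[OF x] .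
    show ?thesis
      using act_P[OF x(1,2), of "fid n" "fid k" k f n] x act_id[OF x(2)]
      by (simp add: fid_fcomp[OF Imor_Fmor] fcomp_fid[OF Imor_length] Fmor_length[OF fid_in(1)])
  qed
  show "act P l (fcomp \<psi> \<phi>) x = act P l \<psi> (act P m \<phi> x)"
    if \<phi>: "\<phi> \<in> Fmor n m" and \<psi>: "\<psi> \<in> Fmor m l" and x: "x \<in> Ops P n" for \<phi> \<psi> n m l x
  proof -
    obtain k f a where x: "f \<in> Imor k n" "a \<in> Ops \<O> k" "x = tensor \<O> k n f a"
      using Ops_P_cases[OF x] .
    obtain j g p where p: "p \<in> Smor k j" "g \<in> Imor j m" "fcomp \<phi> f = fcomp g p"
      "act P m \<phi> x = tensor \<O> j m g (act \<O> j p a)"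
      using act_P_cases[OF x(1,2) \<phi>] x(3) by metis
    obtain i h q where q: "q \<in> Smor j i" "h \<in> Imor i l" "fcomp \<psi> g = fcomp h q"
      "act P l \<psi> (act P m \<phi> x) = tensor \<O> i l h (act \<O> i q (act \<O> j p a))"
      using act_P_cases[OF p(2) act_closed[OF p(1) x(2)] \<psi>] p(4) by metis
    \<comment> \<open>Two successive factorizations compose: \<open>h\<close> after
      \<open>fcomp q p\<close> factors the composite, so a single call of \<open>act_P\<close>
      suffices.\<close>
    have "fcomp (fcomp \<psi> \<phi>) f = fcomp \<psi> (fcomp \<phi> f)"
      using x(1) \<phi> by (intro fcomp_assoc[OF Imor_Fmor]) (auto dest: Fmor_length)
    also have "\<dots> = fcomp (fcomp \<psi> g) p"
      unfolding p(3) using p by (intro fcomp_assoc[OF Smor_Fmor, symmetric]) (auto dest: Imor_length)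
    also have "\<dots> = fcomp h (fcomp q p)"
      unfolding q(3) using p q by (intro fcomp_assoc[OF Smor_Fmor]) (auto dest: Smor_length)
    finally have "act P l (fcomp \<psi> \<phi>) x = tensor \<O> i l h (act \<O> i (fcomp q p) a)"
      unfolding x(3) using p q \<phi> \<psi> fcomp_Smor
      by (intro act_P[OF x(1,2)]) (auto dest: Fmor_length[OF fcomp_Fmor])
    then show ?thesis unfolding q(4) act_comp[OF p(1) q(1) x(2)] .
  qed
  show "mul P [n] [x] (iota P) = x" if x: "x \<in> Ops P n" for x n
  proof -
    obtain k f a where x: "f \<in> Imor k n" "a \<in> Ops \<O> k" "x = tensor \<O> k n f a"
      using Ops_P_cases[OF x] .
    have "mul P [n] [x] (iota P) = tensor \<O> (sum_list (map (\<lambda>_. k) (fid 1))) (sum_list [n])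
      (star [n] (map (\<lambda>_. f) [0..<length [n]]) (fid 1)) (mul \<O> (map (\<lambda>_. k) (fid 1)) (map (\<lambda>_. a) (fid 1)) (iota \<O>))"
      unfolding iota_P using mul_P[of "fid 1" 1 "[n]" "iota \<O>" "[x]" "\<lambda>_. f" "\<lambda>_. k" "\<lambda>_. a"] x iota_closed by simp
    also have "\<dots> = x"
      using x mul_iota_right[OF x(2)] by (simp add: fid_def star_def map_idI)
    finally show ?thesis .
  qed
  show "mul P (replicate n 1) (replicate n (iota P)) x = x" if x: "x \<in> Ops P n" for x n
  proof -
    obtain k f a where x: "f \<in> Imor k n" "a \<in> Ops \<O> k" "x = tensor \<O> k n f a"
      using Ops_P_cases[OF x] .
    have "mul P (replicate n 1) (replicate n (iota P)) (tensor \<O> k (length (replicate n (1 :: nat))) f a) =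
      tensor \<O> (sum_list (map (\<lambda>_. 1) f)) (sum_list (replicate n 1))
      (star (replicate n 1) (map (\<lambda>_. fid 1) [0..<length (replicate n (1 :: nat))]) f)
      (mul \<O> (map (\<lambda>_. 1) f) (map (\<lambda>_. iota \<O>) f) a)"
      using x iota_closed by (intro mul_P) (auto simp: iota_P)
    moreover have "map (\<lambda>_. fid 1) [0..<n] = replicate n (fid 1)" "map (\<lambda>_. 1 :: nat) f = replicate k 1"
      "map (\<lambda>_. iota \<O>) f = replicate k (iota \<O>)" "sum_list (replicate n 1) = n" "sum_list (replicate k 1) = k"
      using Imor_length[OF x(1)] by (auto simp: map_replicate_const sum_list_replicate)
    ultimately show ?thesis
      using x mul_iota_left[OF x(2)] star_units[OF Imor_Fmor[OF x(1)]] by (simp only: length_replicate)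
  qed
qed (rule mul_P_assoc mul_P_act; assumption)+

end

section \<open>Action on morphisms and functoriality\<close>

text \<open>Independence of the representative holds because \<open>h\<close> commutes with the
  action of permutations, which are surjections.\<close>

lemma P_arr_tensor:
  assumes "regular_operad \<O>" "regular_operad \<O>'" and h: "h \<in> operad_hom Smor \<O> \<O>'"
    and fa: "f \<in> Imor k n" "a \<in> Ops \<O> k"
  shows "P_arr \<O> \<O>' h n (tensor \<O> k n f a) = tensor \<O>' k n f (h k a)"
proof -
  interpret O: regular_operad \<O> by fact
  interpret O': regular_operad \<O>' by fact
  have "tensor \<O>' l n g (h l b) = tensor \<O>' k n f (h k a)"
    if g: "g \<in> Imor l n" "b \<in> Ops \<O> l" "tensor \<O> k n f a = tensor \<O> l n g b" for l g b
  proof -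
    obtain \<sigma> where \<sigma>: "l = k" "\<sigma> \<in> Perm k" "f = fcomp g \<sigma>" "b = act \<O> k \<sigma> a"
      using g(3) unfolding O.tensor_eq_iff[OF fa g(1,2)] by blast
    then show ?thesis
      using O'.tensor_eqI[of g k n \<sigma> k "h k a"] g fa operad_hom_closed[OF h] operad_homD(4)[OF h, of \<sigma> k k a]
      by auto
  qed
  note * = this
  have "(THE y. \<exists>l g b. g \<in> Imor l n \<and> b \<in> Ops \<O> l \<and> tensor \<O> k n f a = tensor \<O> l n g b \<and>
      y = tensor \<O>' l n g (h l b)) = tensor \<O>' k n f (h k a)"
  proof (rule the_equality, goal_cases)
    case 1
    show ?case using fa by blast
  next
    case (2 y)
    then show ?case using * by blast
  qed
  then show ?thesis
    unfolding P_arr_def using O.tensor_in_Ops[OF fa] by simp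
qed

text \<open>A morphism leaves injections untouched, so one factorization, or one \<open>star\<close>
  of injections, serves both operads; on operations, \<open>h\<close> commutes with surjections and
  products.\<close>

lemma P_arr_hom:
  assumes O: "regular_operad \<O>" and O': "regular_operad \<O>'" and h: "h \<in> operad_hom Smor \<O> \<O>'"
  shows "P_arr \<O> \<O>' h \<in> operad_hom Fmor (P_ob \<O>) (P_ob \<O>')"
  unfolding operad_hom_def mem_Collect_eq
proof (intro conjI allI impI)
  interpret O: regular_operad \<O> by fact
  interpret O': regular_operad \<O>' by fact
  note arr = P_arr_tensor[OF assms]
  show "P_arr \<O> \<O>' h n \<in> Ops O.P n \<rightarrow>\<^sub>E Ops O'.P n" for n
  proof (rule PiE_I)
    fix x assume "x \<in> Ops O.P n"
    then show "P_arr \<O> \<O>' h n x \<in> Ops O'.P n"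
      by (rule O.Ops_P_cases) (use operad_hom_closed[OF h] in \<open>auto simp: arr\<close>)
  qed (simp add: P_arr_def)
  show "P_arr \<O> \<O>' h 1 (iota O.P) = iota O'.P"
    unfolding O.iota_P O'.iota_P using O.iota_closed operad_homD(2)[OF h] by (simp add: arr)
  fix n m \<phi> x assume "\<phi> \<in> Fmor n m \<and> x \<in> Ops O.P n"
  then have \<phi>: "\<phi> \<in> Fmor n m" and x: "x \<in> Ops O.P n" by auto
  obtain k f a where x: "f \<in> Imor k n" "a \<in> Ops \<O> k" "x = tensor \<O> k n f a"
    using O.Ops_P_cases[OF x] .
  obtain l g p where p: "p \<in> Smor k l" "g \<in> Imor l m" "fcomp \<phi> f = fcomp g p"
    "act O.P m \<phi> x = tensor \<O> l m g (act \<O> l p a)"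
    using O.act_P_cases[OF x(1,2) \<phi>] x(3) by metis
  have "act O'.P m \<phi> (tensor \<O>' k n f (h k a)) = tensor \<O>' l m g (act \<O>' l p (h k a))"
    using x(1) p operad_hom_closed[OF h x(2)] \<phi> by (intro O'.act_P) (auto dest: Fmor_length)
  then show "P_arr \<O> \<O>' h m (act O.P m \<phi> x) = act O'.P m \<phi> (P_arr \<O> \<O>' h n x)"
    unfolding p(4) using x p by (simp add: arr O.act_closed[OF p(1)] operad_homD(4)[OF h p(1)])
next
  interpret O: regular_operad \<O> by fact
  interpret O': regular_operad \<O>' by fact
  note arr = P_arr_tensor[OF assms]
  fix ns ys x assume "has_arities O.P ns ys \<and> x \<in> Ops O.P (length ns)"
  then have ys: "has_arities O.P ns ys" and x: "x \<in> Ops O.P (length ns)" by auto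
  obtain k f a where x: "f \<in> Imor k (length ns)" "a \<in> Ops \<O> k" "x = tensor \<O> k (length ns) f a"
    using O.Ops_P_cases[OF x] .
  have l: "length ys = length ns" using has_arities_length[OF ys] .
  define ks where "ks i = O.rep_arity (ns ! i) (ys ! i)" for i
  define g where "g i = O.rep_inj (ns ! i) (ys ! i)" for i
  define b where "b i = O.rep_op (ns ! i) (ys ! i)" for i
  have B: "g i \<in> Imor (ks i) (ns ! i)" "b i \<in> Ops \<O> (ks i)"
    "ys ! i = tensor \<O> (ks i) (ns ! i) (g i) (b i)" if "i < length ns" for i
    unfolding ks_def g_def b_def using O.rep[of "ys ! i" "ns ! i"] ys that
    by (auto simp: list_all2_conv_all_nth)
  have fl: "length f = k" "\<And>i. i \<in> set f \<Longrightarrow> i < length ns" using x(1) by (auto simp: Imor_def Fmor_def)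
  have "mul O'.P ns (map2 (P_arr \<O> \<O>' h) ns ys) (P_arr \<O> \<O>' h (length ns) x) =
    tensor \<O>' (sum_list (map ks f)) (sum_list ns) (star ns (map g [0..<length ns]) f)
      (mul \<O>' (map ks f) (map (\<lambda>i. h (ks i) (b i)) f) (h k a))"
    unfolding x(3) arr[OF x(1,2)] using x B operad_hom_closed[OF h] l arr
    by (intro O'.mul_P) auto
  moreover have "mul O.P ns ys x = tensor \<O> (sum_list (map ks f)) (sum_list ns) (star ns (map g [0..<length ns]) f)
      (mul \<O> (map ks f) (map b f) a)"
    unfolding x(3) using x B l by (intro O.mul_P) auto
  moreover have "star ns (map g [0..<length ns]) f \<in> Imor (sum_list (map ks f)) (sum_list ns)"
    using x B by (intro star_Imor) auto
  moreover have "mul \<O> (map ks f) (map b f) a \<in> Ops \<O> (sum_list (map ks f))"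
    using B(2) by (intro O.mul_P_closed_map[OF x(1,2)])
  moreover have "h (sum_list (map ks f)) (mul \<O> (map ks f) (map b f) a) =
      mul \<O>' (map ks f) (map (\<lambda>i. h (ks i) (b i)) f) (h k a)"
  proof -
    have "has_arities \<O> (map ks f) (map b f)"
      using fl B(2) by (auto simp: list_all2_conv_all_nth)
    moreover have "map2 h (map ks f) (map b f) = map (\<lambda>i. h (ks i) (b i)) f"
      by (intro nth_equalityI) auto
    ultimately show ?thesis using operad_homD(3)[OF h, of "map ks f" "map b f" a] x(2) fl(1) by simp
  qed
  ultimately show "P_arr \<O> \<O>' h (sum_list ns) (mul O.P ns ys x) =
      mul O'.P ns (map2 (P_arr \<O> \<O>' h) ns ys) (P_arr \<O> \<O>' h (length ns) x)"
    by (simp add: arr)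
qed

lemma regular_operadI: "operad Smor \<O> \<Longrightarrow> regular_operad \<O>"
  by (simp add: regular_operad_def fin_operad_Smor)

lemma functor_P_of: "is_functor (RegOp :: 'u elt operad_cat) FOp P_of"
proof (intro is_functor.intro is_functor_axioms.intro)
  show "category (RegOp :: 'u elt operad_cat)" "category (FOp :: 'u elt operad_cat)"
    by (simp_all add: RegOp_def FOp_def category_Op_cat)
next
  fix X :: "'u elt operad" assume "X \<in> Ob RegOp"
  then have X: "regular_operad X" by (simp add: RegOp_def Op_cat_simps regular_operadI)
  then interpret X: regular_operad X .
  show "on_ob P_of X \<in> Ob FOp"
    using X.operad_P by (simp add: FOp_def P_of_def Op_cat_simps)
  have id: "(\<lambda>n. \<lambda>a \<in> Ops X n. a) \<in> operad_hom Smor X X"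
    using category.Ident_in_Hom[OF category_Op_cat, of X Smor] X.operad_axioms by (simp add: Op_cat_simps)
  have "P_arr X X (\<lambda>n. \<lambda>a \<in> Ops X n. a) n x = (\<lambda>x \<in> Ops X.P n. x) x" for n x
  proof (cases "x \<in> Ops X.P n")
    case True
    then show ?thesis
      by (rule X.Ops_P_cases) (auto simp: P_arr_tensor[OF X X id] X.tensor_in_Ops)
  qed (simp add: P_arr_def)
  then show "on_arr P_of X X (Ident RegOp X) = Ident FOp (on_ob P_of X)"
    by (auto simp: RegOp_def FOp_def P_of_def Op_cat_simps fun_eq_iff)
next
  fix X Y :: "'u elt operad" and f assume "X \<in> Ob RegOp" "Y \<in> Ob RegOp" "f \<in> Hom RegOp X Y"
  then show "on_arr P_of X Y f \<in> Hom FOp (on_ob P_of X) (on_ob P_of Y)"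
    by (simp add: RegOp_def FOp_def P_of_def Op_cat_simps regular_operadI P_arr_hom)
next
  fix X Y Z :: "'u elt operad" and f g
  assume *: "X \<in> Ob RegOp" "Y \<in> Ob RegOp" "Z \<in> Ob RegOp" "f \<in> Hom RegOp X Y" "g \<in> Hom RegOp Y Z"
  then have X: "regular_operad X" and Y: "regular_operad Y" and Z: "regular_operad Z"
    and f: "f \<in> operad_hom Smor X Y" and g: "g \<in> operad_hom Smor Y Z"
    by (auto simp: RegOp_def Op_cat_simps regular_operadI)
  interpret X: regular_operad X by (rule X)
  have gf: "(\<lambda>n. compose (Ops X n) (g n) (f n)) \<in> operad_hom Smor X Z"
    using category.Cmp_in_Hom[OF category_Op_cat, of X Smor Y Z f g] * by (simp add: RegOp_def Op_cat_simps)
  have "P_arr X Z (\<lambda>n. compose (Ops X n) (g n) (f n)) n x =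
      compose (Ops X.P n) (P_arr Y Z g n) (P_arr X Y f n) x" for n x
  proof (cases "x \<in> Ops X.P n")
    case True
    then show ?thesis
      by (rule X.Ops_P_cases) (auto simp: P_arr_tensor[OF X Z gf] P_arr_tensor[OF X Y f] P_arr_tensor[OF Y Z g]
        X.tensor_in_Ops operad_hom_closed[OF f] compose_eq)
  qed (simp add: P_arr_def compose_def)
  then show "on_arr P_of X Z (Cmp RegOp X Y Z g f) =
      Cmp FOp (on_ob P_of X) (on_ob P_of Y) (on_ob P_of Z) (on_arr P_of Y Z g) (on_arr P_of X Y f)"
    by (auto simp: RegOp_def FOp_def P_of_def Op_cat_simps fun_eq_iff)
qed

section \<open>The natural isomorphism\<close>

lemma functor_comp:
  assumes "is_functor C D F" "is_functor D E G"
  shows "is_functor C E (G \<circ>\<^sub>F F)"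
proof -
  interpret F: is_functor C D F by fact
  interpret G: is_functor D E G by fact
  show ?thesis
    by unfold_locales
      (simp_all add: ftor_comp_def F.on_ob_in_Ob G.on_ob_in_Ob F.on_arr_in_Hom G.on_arr_in_Hom
        F.on_arr_Ident G.on_arr_Ident F.on_arr_Cmp G.on_arr_Cmp)
qed

context regular_operad
begin

abbreviation "EP \<equiv> E_ob Fmor P"

sublocale P: fin_operad Fmor P
  by (rule fin_operad_Fmor) (rule operad_P)

text \<open>The class \<open>[f, a]\<close> is sent to \<open>a(x\<^bsub>f(1)\<^esub>, \<dots>, x\<^bsub>f(k)\<^esub>)\<close>. The term depends
  on the chosen representative, but only up to provable equality (\<open>provable_permute\<close>).\<close>

definition unpack :: "'u elt intp"
  where "unpack n x = App (rep_op n x) (map Var (rep_inj n x))"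

definition pack :: "'u elt intp"
  where "pack n a = generic n (tensor \<O> n n (fid n) a)"

lemma symbol_map_unpack: "symbol_map EP E unpack"
  unfolding symbol_map_def
proof (intro allI ballI)
  fix n x assume "x \<in> Sym EP n"
  then have "x \<in> Ops P n" by simp
  from rep(1,2)[OF this] show "unpack n x \<in> terms (Sym E) n"
    by (auto simp: unpack_def terms_App_iff Imor_def Fmor_def)
qed

text \<open>The permutation between the representatives is a surjection, so the action axiom of the
  regular theory equates the two terms.\<close>

lemma provable_permute:
  assumes "f \<in> Imor k n" "a \<in> Ops \<O> k" "g \<in> Imor l n" "b \<in> Ops \<O> l"
    and "tensor \<O> k n f a = tensor \<O> l n g b" and "length ts = n" "set ts \<subseteq> terms (Ops \<O>) m"
  shows "provable E m (App a (map ((!) ts) f)) (App b (map ((!) ts) g))"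
proof -
  obtain \<sigma> where \<sigma>: "l = k" "\<sigma> \<in> Perm k" "f = fcomp g \<sigma>" "b = act \<O> k \<sigma> a"
    using assms(5) unfolding tensor_eq_iff[OF assms(1-4)] by blast
  have "map ((!) ts) f = map ((!) (map ((!) ts) g)) \<sigma>"
    using assms(3) \<sigma> map_nth_Fmor[of \<sigma> k k g "(!) ts"]
    by (auto simp: map_nth_fcomp Imor_length Smor_Fmor)
  moreover have "set (map ((!) ts) g) \<subseteq> terms (Ops \<O>) m"
    using assms(3,6,7) by (auto simp: Imor_def Fmor_def subset_iff)
  ultimately show ?thesis
    unfolding \<sigma>(4) using provable_act[of \<sigma> k k a "map ((!) ts) g" m] \<sigma> assms(2,3)
    by (auto simp: Imor_length)
qed

text \<open>Lets later proofs compute \<open>unpack\<close> with any representative instead of the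
  one chosen by \<open>rep\<close>.\<close>

lemma extend_unpack:
  assumes "f \<in> Imor k n" "a \<in> Ops \<O> k" "length ts = n"
    "set (map (extend unpack) ts) \<subseteq> terms (Ops \<O>) m"
  shows "provable E m (extend unpack (App (tensor \<O> k n f a) ts)) (App a (map (\<lambda>i. extend unpack (ts ! i)) f))"
proof -
  let ?x = "tensor \<O> k n f a" and ?ts = "map (extend unpack) ts"
  have x: "?x \<in> Ops P n" using assms by auto
  have "provable E m (App (rep_op n ?x) (map ((!) ?ts) (rep_inj n ?x))) (App a (map ((!) ?ts) f))"
    using assms rep[OF x] by (intro provable_permute) auto
  moreover have "map ((!) ?ts) f = map (\<lambda>i. extend unpack (ts ! i)) f"
    using assms by (auto simp: Imor_def Fmor_def)
  ultimately show ?thesis using assms(3) by (simp add: unpack_def comp_def)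
qed

lemma extend_unpack_vars:
  assumes "f \<in> Imor k n" "a \<in> Ops \<O> k" "\<phi> \<in> Fmor n m"
  shows "provable E m (extend unpack (App (tensor \<O> k n f a) (map Var \<phi>))) (App a (map Var (fcomp \<phi> f)))"
proof -
  have "map (\<lambda>i. extend unpack (map Var \<phi> ! i)) f = map Var (fcomp \<phi> f)"
    using assms by (auto simp: Imor_def Fmor_def fcomp_def)
  moreover have "length (map Var \<phi>) = n" "set (map (extend unpack) (map Var \<phi>)) \<subseteq> terms (Ops \<O>) m"
    using assms(3) by (auto simp: Fmor_def)
  ultimately show ?thesis
    using extend_unpack[OF assms(1,2)] by metis
qed

lemma extend_unpack_generic:
  assumes "f \<in> Imor k n" "a \<in> Ops \<O> k"
  shows "provable E n (extend unpack (generic n (tensor \<O> k n f a))) (App a (map Var f))"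
  using extend_unpack_vars[OF assms fid_in(1)] fid_fcomp[OF Imor_Fmor[OF assms(1)]]
  by (simp add: generic_def fid_def)

text \<open>Unlike for \<open>pack\<close>, images of axioms are not axioms: injections turn into
  choices of variables, and only surjective actions and products of the given operad are left to
  axioms.\<close>

lemma unpack_interpretation: "unpack \<in> interpretations EP E"
proof -
  have "provable E l (extend unpack s) (extend unpack t)" if "(l, s, t) \<in> Ax EP" for l s t
    using that
  proof (cases rule: P.Ax_E_cases)
    case 1
    have "provable E 1 (extend unpack (App (iota P) (map Var [0]))) (App (iota \<O>) (map Var (fcomp [0] (fid 1))))"
      unfolding iota_P using iota_closed by (intro extend_unpack_vars) (auto simp: Fmor_def)
    moreover have "provable E 1 (App (iota \<O>) [Var 0]) (Var 0)" by (intro provable_iota) simp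
    ultimately show ?thesis unfolding 1 by (auto simp: fid_def fcomp_def intro: provable.trans)
  next
    case (2 m \<tau> x)
    obtain k f a where x: "f \<in> Imor k m" "a \<in> Ops \<O> k" "x = tensor \<O> k m f a"
      using Ops_P_cases[OF 2(2)] .
    obtain j g p where p: "p \<in> Smor k j" "g \<in> Imor j l" "fcomp \<tau> f = fcomp g p"
      "act P l \<tau> x = tensor \<O> j l g (act \<O> j p a)"
      using act_P_cases[OF x(1,2) 2(1)] x(3) by metis
    \<comment> \<open>\<open>\<tau>\<close> may fail to be surjective. Only the surjective part
      \<open>p\<close> of \<open>fcomp \<tau> f\<close> passes through an axiom of the regular
      theory; \<open>g\<close> merely selects variables.\<close>
    have "provable E l (extend unpack s) (App a (map Var (fcomp \<tau> f)))"
      unfolding 2 x(3) using x(1,2) 2(1) by (rule extend_unpack_vars)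
    moreover have "map Var (fcomp \<tau> f) = map ((!) (map Var g :: 'u elt trm list)) p"
      using map_nth_Fmor[OF Smor_Fmor[OF p(1)] Imor_length[OF p(2)], of "Var :: nat \<Rightarrow> 'u elt trm"]
      unfolding p(3) map_nth_fcomp by (rule HOL.sym)
    moreover have "provable E l (App a (map ((!) (map Var g)) p)) (App (act \<O> j p a) (map Var g))"
      using p x by (intro provable_act) (auto simp: Imor_def Fmor_def)
    moreover have "provable E l (extend unpack t) (App (act \<O> j p a) (map Var g))"
      unfolding 2(4) p(4) using p x act_closed by (intro extend_unpack_generic) auto
    ultimately show ?thesis by (metis provable.sym provable.trans)
  next
    case (3 ns ys x)
    obtain k f a where x: "f \<in> Imor k (length ns)" "a \<in> Ops \<O> k" "x = tensor \<O> k (length ns) f a"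
      using Ops_P_cases[OF 3(3)] .
    have ly: "length ys = length ns" using has_arities_length[OF 3(2)] .
    define ks where "ks i = rep_arity (ns ! i) (ys ! i)" for i
    define g where "g i = rep_inj (ns ! i) (ys ! i)" for i
    define b where "b i = rep_op (ns ! i) (ys ! i)" for i
    have B: "g i \<in> Imor (ks i) (ns ! i)" "b i \<in> Ops \<O> (ks i)"
      "ys ! i = tensor \<O> (ks i) (ns ! i) (g i) (b i)" if "i < length ns" for i
      unfolding ks_def g_def b_def using rep[of "ys ! i" "ns ! i"] 3(2) that
      by (auto simp: list_all2_conv_all_nth)
    have fl: "length f = k" "\<And>i. i \<in> set f \<Longrightarrow> i < length ns" using x(1) by (auto simp: Imor_def Fmor_def)
    let ?off = "\<lambda>i. sum_list (take i ns)"
    let ?arg = "\<lambda>i. App (ys ! i) (map Var [?off i..<?off (Suc i)])"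
    \<comment> \<open>The variables that survive in the \<open>i\<close>-th argument: those of its
      block that \<open>g i\<close> selects.\<close>
    let ?v = "\<lambda>i. map (Var :: nat \<Rightarrow> 'u elt trm) (map ((+) (?off i)) (g i))"
    have arg: "provable E l (extend unpack (?arg i)) (App (b i) (?v i))" if i: "i < length ns" for i
    proof -
      have "[?off i..<?off (Suc i)] \<in> Fmor (ns ! i) l"
        using i sum_list_take_mono[of "Suc i" "length ns" ns] 3(1) by (auto simp: Fmor_def sum_list_take_Suc)
      from extend_unpack_vars[OF B(1,2)[OF i] this]
      have "provable E l (extend unpack (?arg i)) (App (b i) (map Var (fcomp [?off i..<?off (Suc i)] (g i))))"
        unfolding B(3)[OF i] .
      moreover have "fcomp [?off i..<?off (Suc i)] (g i) = map ((+) (?off i)) (g i)"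
        using i B(1)[OF i] by (auto simp: fcomp_def Imor_def Fmor_def sum_list_take_Suc subset_iff)
      ultimately show ?thesis by simp
    qed
    have v: "set (?v i) \<subseteq> terms (Ops \<O>) l" if "i < length ns" for i
      using B(1)[OF that] offset_less[OF that] 3(1) by (auto simp: Imor_def Fmor_def subset_iff)
    \<comment> \<open>Only the arguments listed by \<open>f\<close> remain; inner operations outside
      its image disappear.\<close>
    have "provable E l (extend unpack s) (App a (map (\<lambda>i. extend unpack (map ?arg [0..<length ns] ! i)) f))"
      unfolding 3(4) x(3)
    proof (rule extend_unpack[OF x(1,2)])
      have "extend unpack (?arg i) \<in> terms (Ops \<O>) l" if "i < length ns" for i
        using provable_terms[OF eq_theory_E arg[OF that]] by simp
      then show "set (map (extend unpack) (map ?arg [0..<length ns])) \<subseteq> terms (Ops \<O>) l" by auto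
    qed simp
    also have "map (\<lambda>i. extend unpack (map ?arg [0..<length ns] ! i)) f = map (\<lambda>i. extend unpack (?arg i)) f"
      using fl(2) by simp
    finally have "provable E l (extend unpack s) (App a (map (\<lambda>i. extend unpack (?arg i)) f))" .
    moreover have "provable E l (App a (map (\<lambda>i. extend unpack (?arg i)) f)) (App a (map (\<lambda>i. App (b i) (?v i)) f))"
      using x(2) fl arg by (intro provable.cong) auto
    \<comment> \<open>The multiplication axiom of the regular theory. The surviving variables,
      concatenated along \<open>f\<close>, are those listed by \<open>star\<close>, the injection of
      the product class.\<close>
    moreover have "provable E l (App a (map (\<lambda>i. App (b i) (?v i)) f))
        (App (mul \<O> (map ks f) (map b f) a) (map Var (star ns (map g [0..<length ns]) f)))"
    proof -
      have "map length (map ?v f) = map ks f"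
        using fl(2) Imor_length[OF B(1)] by auto
      moreover have "map2 App (map b f) (map ?v f) = map (\<lambda>i. App (b i) (?v i)) f"
        by (intro nth_equalityI) auto
      moreover have "concat (map ?v f) = map Var (star ns (map g [0..<length ns]) f)"
        using fl(2) by (auto simp: star_def map_concat comp_def intro!: arg_cong[where f = concat])
      moreover have "has_arities \<O> (map ks f) (map b f)"
        using fl B(2) by (auto simp: list_all2_conv_all_nth)
      moreover have "set (concat (map ?v f)) \<subseteq> terms (Ops \<O>) l" using v fl(2) by auto
      ultimately show ?thesis
        using provable_mul[of "map ?v f" "map b f" a l] x(2) fl(1) by (simp only: length_map)
    qed
    moreover have "provable E l (extend unpack t)
        (App (mul \<O> (map ks f) (map b f) a) (map Var (star ns (map g [0..<length ns]) f)))"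
    proof -
      have "mul P ns ys x = tensor \<O> (sum_list (map ks f)) (sum_list ns) (star ns (map g [0..<length ns]) f)
          (mul \<O> (map ks f) (map b f) a)"
        unfolding x(3) using x B ly by (intro mul_P) auto
      moreover have "star ns (map g [0..<length ns]) f \<in> Imor (sum_list (map ks f)) (sum_list ns)"
        using x B by (intro star_Imor) auto
      moreover have "mul \<O> (map ks f) (map b f) a \<in> Ops \<O> (sum_list (map ks f))"
        using B(2) by (intro mul_P_closed_map[OF x(1,2)])
      ultimately show ?thesis unfolding 3(1,5) using extend_unpack_generic by simp
    qed
    ultimately show ?thesis by (meson provable.sym provable.trans)
  qed
  then show ?thesis using symbol_map_unpack by (auto simp: interpretations_iff)
qed

lemma extend_pack: "extend pack (App a ts) = App (tensor \<O> (length ts) (length ts) (fid (length ts)) a) (map (extend pack) ts)"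
  by (simp add: pack_def subst_generic)

lemma extend_pack_generic: "extend pack (generic n a) = generic n (tensor \<O> n n (fid n) a)"
  unfolding generic_def extend_pack by simp

lemma pack_in_Ops: "a \<in> Ops \<O> n \<Longrightarrow> tensor \<O> n n (fid n) a \<in> Ops P n"
  by auto

text \<open>The map from \<open>a\<close> to \<open>[1, a]\<close> is the unit of the adjunction: it
  respects unit, surjections and products, so axioms go to axioms.\<close>

lemma pack_interpretation: "pack \<in> interpretations E EP"
proof -
  have "symbol_map E EP pack"
    unfolding symbol_map_def pack_def by (auto simp: generic_def terms_App_iff)
  moreover have "(l, extend pack s, extend pack t) \<in> Ax EP" if "(l, s, t) \<in> Ax E" for l s t
    using that
  proof (cases rule: Ax_E_cases)
    case 1
    then show ?thesis using P.Ax_E_iota iota_P unfolding 1 extend_pack by simp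
  next
    case (2 m \<tau> a)
    \<comment> \<open>As \<open>\<tau>\<close> is surjective, its factorization can be taken with
      the identity as injective part.\<close>
    have "act P l \<tau> (tensor \<O> m m (fid m) a) = tensor \<O> l l (fid l) (act \<O> l \<tau> a)"
      using 2(1,2) by (intro act_P) (auto simp: Smor_length fcomp_fid fid_fcomp[OF Smor_Fmor])
    then show ?thesis
      using P.Ax_E_act[OF Smor_Fmor[OF 2(1)] pack_in_Ops[OF 2(2)]] Smor_length[OF 2(1)]
      unfolding 2(3,4) extend_pack extend_pack_generic by (simp add: comp_def)
  next
    case (3 ns bs a)
    have lb: "length bs = length ns" using has_arities_length[OF 3(2)] .
    have b: "bs ! i \<in> Ops \<O> (ns ! i)" if "i < length ns" for i
      using 3(2) that by (simp add: list_all2_conv_all_nth)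
    let ?ys = "map (\<lambda>i. tensor \<O> (ns ! i) (ns ! i) (fid (ns ! i)) (bs ! i)) [0..<length ns]"
    have "mul P ns ?ys (tensor \<O> (length ns) (length ns) (fid (length ns)) a) =
      tensor \<O> (sum_list (map ((!) ns) (fid (length ns)))) (sum_list ns)
        (star ns (map (\<lambda>i. fid (ns ! i)) [0..<length ns]) (fid (length ns)))
        (mul \<O> (map ((!) ns) (fid (length ns))) (map ((!) bs) (fid (length ns))) a)"
      using 3(3) b by (intro mul_P) auto
    then have m: "mul P ns ?ys (tensor \<O> (length ns) (length ns) (fid (length ns)) a) =
      tensor \<O> (sum_list ns) (sum_list ns) (fid (sum_list ns)) (mul \<O> ns bs a)"
      unfolding star_fid using lb map_nth[of ns] map_nth[of bs] by (simp add: fid_def)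
    have "has_arities P ns ?ys"
      using b by (auto simp: list_all2_conv_all_nth)
    from P.Ax_E_mul[OF this pack_in_Ops[OF 3(3)]]
    have ax: "(sum_list ns, App (tensor \<O> (length ns) (length ns) (fid (length ns)) a) (map (\<lambda>i. App (?ys ! i)
      (map Var [sum_list (take i ns)..<sum_list (take (Suc i) ns)])) [0..<length ns]),
      generic (sum_list ns) (tensor \<O> (sum_list ns) (sum_list ns) (fid (sum_list ns)) (mul \<O> ns bs a))) \<in> Ax EP"
      unfolding m .
    moreover have "extend pack s = App (tensor \<O> (length ns) (length ns) (fid (length ns)) a) (map (\<lambda>i. App (?ys ! i)
      (map Var [sum_list (take i ns)..<sum_list (take (Suc i) ns)])) [0..<length ns])"
      unfolding 3(4) extend_pack by (simp add: extend_pack sum_list_take_Suc comp_def del: extend.simps(2))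
    ultimately show ?thesis unfolding 3(1,5) extend_pack_generic by simp
  qed
  ultimately show ?thesis
    by (auto simp: interpretations_iff intro: provable.axiom)
qed

lemma unpack_pack:
  assumes "a \<in> Ops \<O> n"
  shows "provable E n (extend unpack (pack n a)) (generic n a)"
  using extend_unpack_generic[OF fid_in(3) assms] by (simp add: pack_def generic_def fid_def)

text \<open>This uses an action axiom of the full theory for an injection, here the one in the
  representative of \<open>x\<close>; such axioms are absent from the regular theory unless the
  injection is also surjective.\<close>

lemma pack_unpack:
  assumes "x \<in> Ops P n"
  shows "provable EP n (extend pack (unpack n x)) (generic n x)"
proof -
  let ?k = "rep_arity n x" and ?f = "rep_inj n x" and ?a = "rep_op n x"
  note r = rep[OF assms]
  have lf: "length ?f = ?k" using r(1) by (rule Imor_length)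
  have "act P n ?f (tensor \<O> ?k ?k (fid ?k) ?a) = tensor \<O> ?k n ?f (act \<O> ?k (fid ?k) ?a)"
    using r(1,2) lf by (intro act_P) auto
  then have "act P n ?f (tensor \<O> ?k ?k (fid ?k) ?a) = x"
    using r act_id by simp
  moreover have "(n, App (tensor \<O> ?k ?k (fid ?k) ?a) (map Var ?f), generic n (act P n ?f (tensor \<O> ?k ?k (fid ?k) ?a))) \<in> Ax EP"
    by (intro P.Ax_E_act[OF Imor_Fmor[OF r(1)]] pack_in_Ops r(2))
  moreover have "extend pack (unpack n x) = App (tensor \<O> ?k ?k (fid ?k) ?a) (map Var ?f)"
    unfolding unpack_def extend_pack using lf by (simp add: comp_def)
  ultimately show ?thesis by (auto intro: provable.axiom)
qed

lemma unpack_iso: "is_iso ET EP E (intp_class EP E unpack)"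
  unfolding is_iso_def
proof (intro conjI bexI[of _ "intp_class E EP pack"])
  show "intp_class EP E unpack \<in> Hom ET EP E" "intp_class E EP pack \<in> Hom ET E EP"
    using unpack_interpretation pack_interpretation by (auto simp: ET_simps)
  show "Cmp ET EP E EP (intp_class E EP pack) (intp_class EP E unpack) = Ident ET EP"
    unfolding Cmp_ET_class[OF eq_theory_E P.eq_theory_E unpack_interpretation pack_interpretation] ET_simps(3)
    using pack_unpack by (intro intp_class_eqI) auto
  show "Cmp ET E EP E (intp_class EP E unpack) (intp_class E EP pack) = Ident ET E"
    unfolding Cmp_ET_class[OF P.eq_theory_E eq_theory_E pack_interpretation unpack_interpretation] ET_simps(3)
    using unpack_pack by (intro intp_class_eqI) auto
qed

end

text \<open>Both composites send \<open>[f, a]\<close> to \<open>h(a)\<close> applied to the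
  variables listed by \<open>f\<close>. The transported representative may differ from the one that
  \<open>rep\<close> chooses over \<open>Y\<close>, so one side equals this term only up to
  provability.\<close>

lemma unpack_natural:
  assumes "regular_operad X" "regular_operad Y" and h: "h \<in> operad_hom Smor X Y"
  shows "Cmp ET (E_ob Fmor (P_ob X)) (E_ob Fmor (P_ob Y)) (E_ob Smor Y)
      (intp_class (E_ob Fmor (P_ob Y)) (E_ob Smor Y) (regular_operad.unpack Y))
      (E_arr Fmor (P_ob X) (P_ob Y) (P_arr X Y h)) =
    Cmp ET (E_ob Fmor (P_ob X)) (E_ob Smor X) (E_ob Smor Y)
      (E_arr Smor X Y h) (intp_class (E_ob Fmor (P_ob X)) (E_ob Smor X) (regular_operad.unpack X))"
proof -
  interpret X: regular_operad X by fact
  interpret Y: regular_operad Y by fact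
  have Ph: "hom_intp (P_arr X Y h) \<in> interpretations X.EP Y.EP"
    using P_arr_hom[OF assms] by (rule hom_intp_interpretation[OF X.P.fin_operad_axioms Y.P.fin_operad_axioms])
  have hi: "hom_intp h \<in> interpretations X.E Y.E"
    using h by (rule hom_intp_interpretation[OF X.fin_operad_axioms Y.fin_operad_axioms])
  show ?thesis
    unfolding E_arr_eq Cmp_ET_class[OF Y.P.eq_theory_E Y.eq_theory_E Ph Y.unpack_interpretation]
      Cmp_ET_class[OF X.eq_theory_E Y.eq_theory_E X.unpack_interpretation hi]
  proof (rule intp_class_eqI)
    fix n x assume "x \<in> Sym X.EP n"
    then have x: "x \<in> Ops X.P n" by simp
    let ?k = "X.rep_arity n x" and ?f = "X.rep_inj n x" and ?a = "X.rep_op n x"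
    note r = X.rep[OF x]
    have "P_arr X Y h n x = tensor Y ?k n ?f (h ?k ?a)"
      using P_arr_tensor[OF assms r(1,2)] r(3) by simp
    moreover have "extend (hom_intp h) (X.unpack n x) = App (h ?k ?a) (map Var ?f)"
      unfolding X.unpack_def extend_hom_intp using Imor_length[OF r(1)] by (simp add: comp_def)
    ultimately show "provable Y.E n (extend Y.unpack (generic n (P_arr X Y h n x))) (extend (hom_intp h) (X.unpack n x))"
      using Y.extend_unpack_generic[OF r(1) operad_hom_closed[OF h r(2)]] by simp
  qed
qed

theorem proposition6p1:
  shows "is_functor (RegOp :: 'u elt operad_cat) (FOp :: 'u elt operad_cat) P_of \<and>
    is_functor (FOp :: 'u elt operad_cat) (ET :: 'u elt eqthy_cat) E_fo \<and>
    is_functor (RegOp :: 'u elt operad_cat) (RegET :: 'u elt eqthy_cat) E_ro \<and>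
    is_functor (RegET :: 'u elt eqthy_cat) (ET :: 'u elt eqthy_cat) P_ef \<and>
    naturally_isomorphic (RegOp :: 'u elt operad_cat) (ET :: 'u elt eqthy_cat)
      (E_fo \<circ>\<^sub>F P_of) (P_ef \<circ>\<^sub>F E_ro)"
proof (intro conjI functor_P_of functor_E_fo functor_E_ro functor_P_ef)
  let ?\<eta> = "\<lambda>X :: 'u elt operad. intp_class (E_ob Fmor (P_ob X)) (E_ob Smor X) (regular_operad.unpack X)"
  show "naturally_isomorphic (RegOp :: 'u elt operad_cat) (ET :: 'u elt eqthy_cat)
      (E_fo \<circ>\<^sub>F P_of) (P_ef \<circ>\<^sub>F E_ro)"
    unfolding naturally_isomorphic_def
  proof (intro conjI exI[of _ ?\<eta>] ballI)
    show "is_functor (RegOp :: 'u elt operad_cat) ET (E_fo \<circ>\<^sub>F P_of)"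
      by (rule functor_comp[OF functor_P_of functor_E_fo])
    show "is_functor (RegOp :: 'u elt operad_cat) ET (P_ef \<circ>\<^sub>F E_ro)"
      by (rule functor_comp[OF functor_E_ro functor_P_ef])
    fix X :: "'u elt operad" assume "X \<in> Ob RegOp"
    then have X: "regular_operad X" by (simp add: RegOp_def Op_cat_simps regular_operadI)
    then show "is_iso ET (on_ob (E_fo \<circ>\<^sub>F P_of) X) (on_ob (P_ef \<circ>\<^sub>F E_ro) X) (?\<eta> X)"
      using regular_operad.unpack_iso by (simp add: ftor_comp_def E_fo_def P_of_def P_ef_def E_ro_def)
    fix Y :: "'u elt operad" and h assume "Y \<in> Ob RegOp" "h \<in> Hom RegOp X Y"
    then have "regular_operad Y" "h \<in> operad_hom Smor X Y"
      by (auto simp: RegOp_def Op_cat_simps regular_operadI)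
    from unpack_natural[OF X this]
    show "Cmp ET (on_ob (E_fo \<circ>\<^sub>F P_of) X) (on_ob (E_fo \<circ>\<^sub>F P_of) Y) (on_ob (P_ef \<circ>\<^sub>F E_ro) Y)
        (?\<eta> Y) (on_arr (E_fo \<circ>\<^sub>F P_of) X Y h) =
      Cmp ET (on_ob (E_fo \<circ>\<^sub>F P_of) X) (on_ob (P_ef \<circ>\<^sub>F E_ro) X) (on_ob (P_ef \<circ>\<^sub>F E_ro) Y)
        (on_arr (P_ef \<circ>\<^sub>F E_ro) X Y h) (?\<eta> X)"
      by (simp add: ftor_comp_def E_fo_def P_of_def P_ef_def E_ro_def)
  qed
qed

end
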